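(* Let $(\bar a_i)_{i\in I}$ and $(\bar b_j)_{j\in J}$ be sequences of indiscernibles. (1) The kernel is a $\approx$-invariant: if $(\bar a_i)_{i\in I}\approx(\bar b_j)_{j\in J}$, then $\ker(\bar a_i)_{i\in I}=\ker(\bar b_j)_{j\in J}$. (2) If $(\bar a_i)_{i\in I}$ and $(\bar b_j)_{j\in J}$ are cleanly collinear, then $\ker(\bar a_i)_{i\in I}=\operatorname{dcl}(\{\bar a_i\mid i\in I\})\cap\operatorname{dcl}(\{\bar b_j\mid j\in J\})$. (3) $\ker(\bar a_i)_{i\in I}=\operatorname{dcl}\ker(\bar a_i)_{i\in I}$. (4) $(\bar a_i)_{i\in I}$ is indiscernible over $\ker(\bar a_i)_{i\in I}$.
   Context: $T$ is a complete consistent first-order theory (possibly many-sorted); we work in a big saturated model of $T$, with definable closure $\operatorname{dcl}$. Tuples may be infinite, and $\operatorname{dcl}(\{\bar a_i\mid i\in I\})$ means the definable closure of the set of all entries of all tuples $\bar a_i$. Sequences of indiscernibles are indexed by arbitrary infinite (small) linearly ordered sets. The kernel of a sequence of indiscernibles $(\bar a_i)_{i\in I}$ is the set $$\ker(\bar a_i)_{i\in I}=\{d\mid d\in\operatorname{dcl}(\{\bar a_i\mid i\in I\})\text{ and }(\bar a_i)_{i\in I}\text{ is indiscernible over }d\}$$ (where $d$ ranges over single elements). Two sequences of indiscernibles $(\bar a_i)_{i\in I}$ and $(\bar b_j)_{j\in J}$ are cleanly collinear if one of their two concatenations (the sequence indexed by the disjoint union $I+J$ ordered so that $I<J$, or the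 one indexed by $J+I$ with $J<I$) is indiscernible. $\approx$ denotes the transitive closure of clean collinearity. *)

theory Defs
  imports Main
begin

unbundle cardinal_syntax

section \<open>Many-sorted first-order logic\<close>

record ('s, 'f, 'r) lang =
  sorts :: "'s set"
  funs :: "'f set"
  preds :: "'r set"
  fun_args :: "'f \<Rightarrow> 's list"
  fun_res :: "'f \<Rightarrow> 's"
  pred_args :: "'r \<Rightarrow> 's list"

definition wf_lang :: "('s, 'f, 'r) lang \<Rightarrow> bool" where
  "wf_lang L \<longleftrightarrow>
     (\<forall>f\<in>funs L. set (fun_args L f) \<subseteq> sorts L \<and> fun_res L f \<in> sorts L) \<and>
     (\<forall>R\<in>preds L. set (pred_args L R) \<subseteq> sorts L)"

text \<open>The variable \<^term>\<open>(s, n)\<close> is the \<open>n\<close>-th variable of sort \<open>s\<close>.\<close>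

type_synonym 's var = "'s \<times> nat"

datatype ('s, 'f) tm = Var "'s var" | Fn 'f "('s, 'f) tm list"

datatype ('s, 'f, 'r) fm =
    Falsum
  | Equal "('s, 'f) tm" "('s, 'f) tm"
  | Pred 'r "('s, 'f) tm list"
  | Neg "('s, 'f, 'r) fm"
  | Conj "('s, 'f, 'r) fm" "('s, 'f, 'r) fm"
  | Exists "'s var" "('s, 'f, 'r) fm"

fun tm_sort :: "('s, 'f, 'r) lang \<Rightarrow> ('s, 'f) tm \<Rightarrow> 's" where
  "tm_sort L (Var v) = fst v"
| "tm_sort L (Fn f ts) = fun_res L f"

fun wf_tm :: "('s, 'f, 'r) lang \<Rightarrow> ('s, 'f) tm \<Rightarrow> bool" where
  "wf_tm L (Var v) \<longleftrightarrow> fst v \<in> sorts L"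
| "wf_tm L (Fn f ts) \<longleftrightarrow>
     f \<in> funs L \<and> map (tm_sort L) ts = fun_args L f \<and> (\<forall>t\<in>set ts. wf_tm L t)"

fun wf_fm :: "('s, 'f, 'r) lang \<Rightarrow> ('s, 'f, 'r) fm \<Rightarrow> bool" where
  "wf_fm L Falsum \<longleftrightarrow> True"
| "wf_fm L (Equal t u) \<longleftrightarrow> wf_tm L t \<and> wf_tm L u \<and> tm_sort L t = tm_sort L u"
| "wf_fm L (Pred R ts) \<longleftrightarrow>
     R \<in> preds L \<and> map (tm_sort L) ts = pred_args L R \<and> (\<forall>t\<in>set ts. wf_tm L t)"
| "wf_fm L (Neg \<phi>) \<longleftrightarrow> wf_fm L \<phi>"
| "wf_fm L (Conj \<phi> \<psi>) \<longleftrightarrow> wf_fm L \<phi> \<and> wf_fm L \<psi>"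
| "wf_fm L (Exists v \<phi>) \<longleftrightarrow> fst v \<in> sorts L \<and> wf_fm L \<phi>"

fun fv_tm :: "('s, 'f) tm \<Rightarrow> 's var set" where
  "fv_tm (Var v) = {v}"
| "fv_tm (Fn f ts) = (\<Union>t\<in>set ts. fv_tm t)"

fun fv :: "('s, 'f, 'r) fm \<Rightarrow> 's var set" where
  "fv Falsum = {}"
| "fv (Equal t u) = fv_tm t \<union> fv_tm u"
| "fv (Pred R ts) = (\<Union>t\<in>set ts. fv_tm t)"
| "fv (Neg \<phi>) = fv \<phi>"
| "fv (Conj \<phi> \<psi>) = fv \<phi> \<union> fv \<psi>"
| "fv (Exists v \<phi>) = fv \<phi> - {v}"

definition sentences :: "('s, 'f, 'r) lang \<Rightarrow> ('s, 'f, 'r) fm set" where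
  "sentences L = {\<phi>. wf_fm L \<phi> \<and> fv \<phi> = {}}"

record ('s, 'f, 'r, 'm) struct =
  dom :: "'s \<Rightarrow> 'm set"
  fn :: "'f \<Rightarrow> 'm list \<Rightarrow> 'm"
  rel :: "'r \<Rightarrow> 'm list \<Rightarrow> bool"

text \<open>Sorts are nonempty and pairwise disjoint, so that an element determines its sort.\<close>

definition wf_struct :: "('s, 'f, 'r) lang \<Rightarrow> ('s, 'f, 'r, 'm) struct \<Rightarrow> bool" where
  "wf_struct L M \<longleftrightarrow>
     (\<forall>s\<in>sorts L. dom M s \<noteq> {}) \<and>
     (\<forall>s\<in>sorts L. \<forall>s'\<in>sorts L. s \<noteq> s' \<longrightarrow> dom M s \<inter> dom M s' = {}) \<and>
     (\<forall>f\<in>funs L. \<forall>xs. list_all2 (\<lambda>x s. x \<in> dom M s) xs (fun_args L f) \<longrightarrow>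
        fn M f xs \<in> dom M (fun_res L f))"

definition univ :: "('s, 'f, 'r) lang \<Rightarrow> ('s, 'f, 'r, 'm) struct \<Rightarrow> 'm set" where
  "univ L M = (\<Union>s\<in>sorts L. dom M s)"

definition valid_env ::
  "('s, 'f, 'r) lang \<Rightarrow> ('s, 'f, 'r, 'm) struct \<Rightarrow> ('s var \<Rightarrow> 'm) \<Rightarrow> bool" where
  "valid_env L M e \<longleftrightarrow> (\<forall>v. fst v \<in> sorts L \<longrightarrow> e v \<in> dom M (fst v))"

fun tm_val :: "('s, 'f, 'r, 'm) struct \<Rightarrow> ('s var \<Rightarrow> 'm) \<Rightarrow> ('s, 'f) tm \<Rightarrow> 'm" where
  "tm_val M e (Var v) = e v"
| "tm_val M e (Fn f ts) = fn M f (map (tm_val M e) ts)"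

fun sat :: "('s, 'f, 'r, 'm) struct \<Rightarrow> ('s var \<Rightarrow> 'm) \<Rightarrow> ('s, 'f, 'r) fm \<Rightarrow> bool" where
  "sat M e Falsum \<longleftrightarrow> False"
| "sat M e (Equal t u) \<longleftrightarrow> tm_val M e t = tm_val M e u"
| "sat M e (Pred R ts) \<longleftrightarrow> rel M R (map (tm_val M e) ts)"
| "sat M e (Neg \<phi>) \<longleftrightarrow> \<not> sat M e \<phi>"
| "sat M e (Conj \<phi> \<psi>) \<longleftrightarrow> sat M e \<phi> \<and> sat M e \<psi>"
| "sat M e (Exists v \<phi>) \<longleftrightarrow> (\<exists>x\<in>dom M (fst v). sat M (e(v := x)) \<phi>)"

definition is_model ::
  "('s, 'f, 'r) lang \<Rightarrow> ('s, 'f, 'r, 'm) struct \<Rightarrow> ('s, 'f, 'r) fm set \<Rightarrow> bool" where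
  "is_model L M T \<longleftrightarrow>
     wf_struct L M \<and> (\<forall>\<phi>\<in>T. \<forall>e. valid_env L M e \<longrightarrow> sat M e \<phi>)"

text \<open>
  Consistency and consequence refer to models whose elements are taken from the type of
  formulas. This type is infinite and at least as large as the language, so by the
  downward Loewenheim-Skolem theorem every set of sentences with a model of whatever
  size also has one there: nothing is lost by fixing this type.
\<close>

definition consistent :: "('s, 'f, 'r) lang \<Rightarrow> ('s, 'f, 'r) fm set \<Rightarrow> bool" where
  "consistent L T \<longleftrightarrow> (\<exists>N :: ('s, 'f, 'r, ('s, 'f, 'r) fm) struct. is_model L N T)"

definition entails ::
  "('s, 'f, 'r) lang \<Rightarrow> ('s, 'f, 'r) fm set \<Rightarrow> ('s, 'f, 'r) fm \<Rightarrow> bool" where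
  "entails L T \<phi> \<longleftrightarrow>
     (\<forall>N :: ('s, 'f, 'r, ('s, 'f, 'r) fm) struct. is_model L N T \<longrightarrow> is_model L N {\<phi>})"

definition complete_consistent_theory ::
  "('s, 'f, 'r) lang \<Rightarrow> ('s, 'f, 'r) fm set \<Rightarrow> bool" where
  "complete_consistent_theory L T \<longleftrightarrow>
     wf_lang L \<and> T \<subseteq> sentences L \<and> consistent L T \<and>
     (\<forall>\<phi>\<in>sentences L. entails L T \<phi> \<or> entails L T (Neg \<phi>))"


section \<open>Saturated models and definable closure\<close>

definition small :: "'c rel \<Rightarrow> 'a set \<Rightarrow> bool" where
  "small \<kappa> A \<longleftrightarrow> |A| <o \<kappa>"

text \<open>
  A formula in the variable \<open>x\<close> with parameters from \<open>A\<close> is a pair \<open>(\<phi>, e)\<close> of a formula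
  and an assignment \<open>e\<close> sending the free variables of \<open>\<phi>\<close> other than \<open>x\<close> into \<open>A\<close>; the
  value of \<open>e\<close> at \<open>x\<close> is irrelevant.
\<close>

definition fm_over ::
  "('s, 'f, 'r) lang \<Rightarrow> ('s, 'f, 'r, 'm) struct \<Rightarrow> 'm set \<Rightarrow> 's var \<Rightarrow>
   (('s, 'f, 'r) fm \<times> ('s var \<Rightarrow> 'm)) set" where
  "fm_over L M A x =
     {(\<phi>, e). wf_fm L \<phi> \<and> valid_env L M e \<and> e ` (fv \<phi> - {x}) \<subseteq> A}"

definition realizes ::
  "('s, 'f, 'r, 'm) struct \<Rightarrow> 's var \<Rightarrow> 'm \<Rightarrow>
   (('s, 'f, 'r) fm \<times> ('s var \<Rightarrow> 'm)) set \<Rightarrow> bool" where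
  "realizes M x d p \<longleftrightarrow> d \<in> dom M (fst x) \<and> (\<forall>(\<phi>, e)\<in>p. sat M (e(x := d)) \<phi>)"

definition saturated ::
  "('s, 'f, 'r) lang \<Rightarrow> 'c rel \<Rightarrow> ('s, 'f, 'r, 'm) struct \<Rightarrow> bool" where
  "saturated L \<kappa> M \<longleftrightarrow>
     (\<forall>A x p. A \<subseteq> univ L M \<and> small \<kappa> A \<and> fst x \<in> sorts L \<and> p \<subseteq> fm_over L M A x \<and>
        (\<forall>q. finite q \<and> q \<subseteq> p \<longrightarrow> (\<exists>d. realizes M x d q)) \<longrightarrow>
        (\<exists>d. realizes M x d p))"

text \<open>
  If some sort of \<open>M\<close> is infinite, then saturation for types over fewer than \<open>\<kappa>\<close> parameters
  forces that sort to have at least \<open>\<kappa>\<close> elements, so the conditions below make \<open>M\<close> a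
  saturated model of cardinality exactly \<open>\<kappa>\<close>. The inequality \<open>|univ L M| \<le>o \<kappa>\<close> also admits
  the degenerate case of a theory all of whose sorts are finite. \<open>M\<close> is big in that \<open>\<kappa>\<close>
  exceeds the number of formulas; in particular \<open>\<kappa>\<close> is infinite.
\<close>

definition big_saturated_model ::
  "('s, 'f, 'r) lang \<Rightarrow> ('s, 'f, 'r) fm set \<Rightarrow> 'c rel \<Rightarrow> ('s, 'f, 'r, 'm) struct \<Rightarrow> bool" where
  "big_saturated_model L T \<kappa> M \<longleftrightarrow>
     is_model L M T \<and> Card_order \<kappa> \<and> small \<kappa> {\<phi>. wf_fm L \<phi>} \<and>
     |univ L M| \<le>o \<kappa> \<and> saturated L \<kappa> M"

definition dcl ::
  "('s, 'f, 'r) lang \<Rightarrow> ('s, 'f, 'r, 'm) struct \<Rightarrow> 'm set \<Rightarrow> 'm set" where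
  "dcl L M A =
     {d. \<exists>x \<phi> e. fst x \<in> sorts L \<and> (\<phi>, e) \<in> fm_over L M A x \<and>
         {c \<in> dom M (fst x). sat M (e(x := c)) \<phi>} = {d}}"


section \<open>Sequences of indiscernibles\<close>

text \<open>
  \<open>same_type L M A X f g\<close>: the families \<open>f\<close> and \<open>g\<close> indexed by \<open>X\<close> have the same type
  over \<open>A\<close>. The map \<open>\<pi>\<close> says whether a free variable stands for a member of the family
  (\<open>Inl\<close>) or for a parameter (\<open>Inr\<close>).
\<close>

definition same_type ::
  "('s, 'f, 'r) lang \<Rightarrow> ('s, 'f, 'r, 'm) struct \<Rightarrow> 'm set \<Rightarrow> 'x set \<Rightarrow>
   ('x \<Rightarrow> 'm) \<Rightarrow> ('x \<Rightarrow> 'm) \<Rightarrow> bool" where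
  "same_type L M A X f g \<longleftrightarrow>
     (\<forall>\<phi> \<pi>. wf_fm L \<phi> \<and>
        (\<forall>v\<in>fv \<phi>. \<pi> v \<in> X <+> A \<and>
           case_sum f id (\<pi> v) \<in> dom M (fst v) \<and> case_sum g id (\<pi> v) \<in> dom M (fst v)) \<longrightarrow>
        (sat M (case_sum f id \<circ> \<pi>) \<phi> \<longleftrightarrow> sat M (case_sum g id \<circ> \<pi>) \<phi>))"

text \<open>
  A sequence of (possibly infinite) tuples: \<open>idx\<close> is the index set, ordered by the reflexive
  relation \<open>ord\<close>; \<open>coords\<close> is the set of coordinates of the tuples, and \<open>ent a i k\<close> is
  the \<open>k\<close>-th entry of the \<open>i\<close>-th tuple.
\<close>

record ('i, 'k, 'm) tseq =
  idx :: "'i set"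
  ord :: "'i rel"
  coords :: "'k set"
  ent :: "'i \<Rightarrow> 'k \<Rightarrow> 'm"

definition entries :: "('i, 'k, 'm) tseq \<Rightarrow> 'm set" where
  "entries a = {ent a i k | i k. i \<in> idx a \<and> k \<in> coords a}"

definition increasing :: "('i, 'k, 'm) tseq \<Rightarrow> 'i list \<Rightarrow> bool" where
  "increasing a is \<longleftrightarrow>
     set is \<subseteq> idx a \<and> sorted_wrt (\<lambda>i j. (i, j) \<in> ord a \<and> i \<noteq> j) is"

definition indiscernible_over ::
  "('s, 'f, 'r) lang \<Rightarrow> ('s, 'f, 'r, 'm) struct \<Rightarrow> 'm set \<Rightarrow> ('i, 'k, 'm) tseq \<Rightarrow> bool" where
  "indiscernible_over L M A a \<longleftrightarrow>
     (\<forall>is js. increasing a is \<and> increasing a js \<and> length is = length js \<longrightarrow>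
        same_type L M A ({..<length is} \<times> coords a)
          (\<lambda>(p, k). ent a (is ! p) k) (\<lambda>(p, k). ent a (js ! p) k))"

definition tuple_sequence ::
  "('s, 'f, 'r) lang \<Rightarrow> 'c rel \<Rightarrow> ('s, 'f, 'r, 'm) struct \<Rightarrow> ('i, 'k, 'm) tseq \<Rightarrow> bool" where
  "tuple_sequence L \<kappa> M a \<longleftrightarrow>
     linear_order_on (idx a) (ord a) \<and> infinite (idx a) \<and>
     small \<kappa> (idx a) \<and> small \<kappa> (coords a) \<and>
     (\<forall>k\<in>coords a. \<exists>s\<in>sorts L. \<forall>i\<in>idx a. ent a i k \<in> dom M s)"

definition indiscernible_sequence ::
  "('s, 'f, 'r) lang \<Rightarrow> 'c rel \<Rightarrow> ('s, 'f, 'r, 'm) struct \<Rightarrow> ('i, 'k, 'm) tseq \<Rightarrow> bool" where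
  "indiscernible_sequence L \<kappa> M a \<longleftrightarrow>
     tuple_sequence L \<kappa> M a \<and> indiscernible_over L M {} a"

definition ker ::
  "('s, 'f, 'r) lang \<Rightarrow> ('s, 'f, 'r, 'm) struct \<Rightarrow> ('i, 'k, 'm) tseq \<Rightarrow> 'm set" where
  "ker L M a = {d. d \<in> dcl L M (entries a) \<and> indiscernible_over L M {d} a}"

text \<open>Only used for sequences whose tuples have the same coordinates.\<close>

definition concat_seq ::
  "('i, 'k, 'm) tseq \<Rightarrow> ('j, 'k, 'm) tseq \<Rightarrow> ('i + 'j, 'k, 'm) tseq" where
  "concat_seq a b =
     \<lparr> idx = idx a <+> idx b,
       ord = map_prod Inl Inl ` ord a \<union> map_prod Inr Inr ` ord b \<union>
             (Inl ` idx a) \<times> (Inr ` idx b),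
       coords = coords a,
       ent = case_sum (ent a) (ent b) \<rparr>"

definition cleanly_collinear ::
  "('s, 'f, 'r) lang \<Rightarrow> 'c rel \<Rightarrow> ('s, 'f, 'r, 'm) struct \<Rightarrow>
   ('i, 'k, 'm) tseq \<Rightarrow> ('j, 'k, 'm) tseq \<Rightarrow> bool" where
  "cleanly_collinear L \<kappa> M a b \<longleftrightarrow>
     indiscernible_sequence L \<kappa> M a \<and> indiscernible_sequence L \<kappa> M b \<and>
     coords a = coords b \<and>
     (indiscernible_sequence L \<kappa> M (concat_seq a b) \<or>
      indiscernible_sequence L \<kappa> M (concat_seq b a))"

text \<open>
  A transitive closure needs a single type of indices. This is no restriction when \<open>'i\<close> is
  a free type variable: any finite chain of sequences with indices from various types can
  be re-indexed by one common type, such as the sum of these types.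
\<close>

definition collinear ::
  "('s, 'f, 'r) lang \<Rightarrow> 'c rel \<Rightarrow> ('s, 'f, 'r, 'm) struct \<Rightarrow>
   ('i, 'k, 'm) tseq \<Rightarrow> ('i, 'k, 'm) tseq \<Rightarrow> bool" where
  "collinear L \<kappa> M = (cleanly_collinear L \<kappa> M)\<^sup>+\<^sup>+"

end

theory Submission
  imports Defs
begin

text \<open>
  No saturation is needed: automorphisms are replaced by relations \<open>R\<close> whose pairs may be
  exchanged in formulas without changing their truth value. Such a relation extends uniquely
  along definable closure.

  Since an element \<open>d\<close> of the kernel is fixed when a tuple of the sequence is moved to another
  place, it is definable from every sufficiently long increasing block. If a second sequence
  continues the first one, moving a block into it shows that \<open>d\<close> is definable there as well.
  Conversely, the first sequence is indiscernible over the second, hence over everything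
  definable from it. For (4), finitely many elements of the kernel are definable from any long
  block of tuples; inserting such a block into a given increasing tuple, at whatever place
  there is room for it, allows one to move the tuple while the block, and with it the given
  elements, is under control. (3) follows from (4), and (1) from the symmetry of (2).
\<close>

section \<open>Assignments, renaming of variables, and formulas expressing definability\<close>

lemma tm_val_cong: "(\<And>v. v \<in> fv_tm t \<Longrightarrow> e v = e' v) \<Longrightarrow> tm_val M e t = tm_val M e' t"
proof (induction t)
  case (Fn f ts)
  have "tm_val M e t = tm_val M e' t" if "t \<in> set ts" for t
    by (rule Fn.IH) (use that Fn.prems in auto)
  then have "map (tm_val M e) ts = map (tm_val M e') ts" by simp
  then show ?case by (simp only: tm_val.simps)
qed simp

lemma sat_cong: "(\<And>v. v \<in> fv \<phi> \<Longrightarrow> e v = e' v) \<Longrightarrow> sat M e \<phi> = sat M e' \<phi>"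
proof (induction \<phi> arbitrary: e e')
  case (Equal t u)
  then show ?case using tm_val_cong[of t e e' M] tm_val_cong[of u e e' M] by simp
next
  case (Pred R ts)
  have "tm_val M e t = tm_val M e' t" if "t \<in> set ts" for t
    by (rule tm_val_cong) (use that Pred.prems in auto)
  then have "map (tm_val M e) ts = map (tm_val M e') ts" by simp
  then show ?case by (simp only: sat.simps)
next
  case (Neg \<phi>)
  have "sat M e \<phi> = sat M e' \<phi>" by (rule Neg.IH) (use Neg.prems in simp)
  then show ?case by simp
next
  case (Conj \<phi> \<psi>)
  have "sat M e \<phi> = sat M e' \<phi>" by (rule Conj.IH) (use Conj.prems in simp)
  moreover have "sat M e \<psi> = sat M e' \<psi>" by (rule Conj.IH) (use Conj.prems in simp)
  ultimately show ?case by simp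
next
  case (Exists v \<phi>)
  have "sat M (e(v := x)) \<phi> = sat M (e'(v := x)) \<phi>" for x
    by (rule Exists.IH) (use Exists.prems in auto)
  then show ?case by simp
qed simp

lemma finite_fv_tm: "finite (fv_tm t)"
  by (induction t) auto

lemma finite_fv: "finite (fv \<phi>)"
  by (induction \<phi>) (auto simp: finite_fv_tm)

lemma fv_tm_sorts: "wf_tm L t \<Longrightarrow> v \<in> fv_tm t \<Longrightarrow> fst v \<in> sorts L"
  by (induction t) auto

lemma fv_sorts: "wf_fm L \<phi> \<Longrightarrow> v \<in> fv \<phi> \<Longrightarrow> fst v \<in> sorts L"
  by (induction \<phi>) (auto dest: fv_tm_sorts)

primrec rename_tm :: "('s var \<Rightarrow> 's var) \<Rightarrow> ('s, 'f) tm \<Rightarrow> ('s, 'f) tm" where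
  "rename_tm \<rho> (Var v) = Var (\<rho> v)"
| "rename_tm \<rho> (Fn f ts) = Fn f (map (rename_tm \<rho>) ts)"

lemma fv_rename_tm: "fv_tm (rename_tm \<rho> t) = \<rho> ` fv_tm t"
  by (induction t) auto

lemma tm_val_rename_tm: "tm_val M e (rename_tm \<rho> t) = tm_val M (\<lambda>v. e (\<rho> v)) t"
proof (induction t)
  case (Fn f ts)
  then have "map (tm_val M e \<circ> rename_tm \<rho>) ts = map (tm_val M (\<lambda>v. e (\<rho> v))) ts" by simp
  then show ?case by (simp only: tm_val.simps rename_tm.simps map_map)
qed simp

lemma tm_sort_rename_tm: "(\<And>v. fst (\<rho> v) = fst v) \<Longrightarrow> tm_sort L (rename_tm \<rho> t) = tm_sort L t"
  by (cases t) auto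

lemma wf_rename_tm: "(\<And>v. fst (\<rho> v) = fst v) \<Longrightarrow> wf_tm L t \<Longrightarrow> wf_tm L (rename_tm \<rho> t)"
  by (induction t) (auto simp: tm_sort_rename_tm comp_def)

lemma fresh_var:
  fixes V :: "'s var set"
  assumes "finite V"
  shows "\<exists>n. (s, n) \<notin> V"
proof -
  have "infinite (range (Pair s :: nat \<Rightarrow> 's var))"
    by (simp add: finite_image_iff inj_on_def)
  then show ?thesis using assms by (metis finite_subset image_subsetI)
qed

text \<open>Stated existentially, since bound variables have to be renamed to avoid capture.\<close>

lemma rename_fm:
  assumes "\<And>v. fst (\<rho> v) = fst v" "wf_fm L \<phi>"
  shows "\<exists>\<phi>'. wf_fm L \<phi>' \<and> fv \<phi>' \<subseteq> \<rho> ` fv \<phi> \<and> (\<forall>e. sat M e \<phi>' = sat M (\<lambda>v. e (\<rho> v)) \<phi>)"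
  using assms
proof (induction \<phi> arbitrary: \<rho>)
  case Falsum
  show ?case by (rule exI[of _ Falsum]) simp
next
  case (Equal t u)
  then show ?case
    by (intro exI[of _ "Equal (rename_tm \<rho> t) (rename_tm \<rho> u)"])
      (auto simp: wf_rename_tm tm_sort_rename_tm fv_rename_tm tm_val_rename_tm)
next
  case (Pred R ts)
  let ?\<phi>' = "Pred R (map (rename_tm \<rho>) ts)"
  have "map (tm_val M e \<circ> rename_tm \<rho>) ts = map (tm_val M (\<lambda>v. e (\<rho> v))) ts" for e
    by (simp add: tm_val_rename_tm)
  then have *: "\<forall>e. sat M e ?\<phi>' = sat M (\<lambda>v. e (\<rho> v)) (Pred R ts)"
    by (intro allI) (simp only: sat.simps map_map)
  have "map (tm_sort L \<circ> rename_tm \<rho>) ts = map (tm_sort L) ts"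
    using Pred.prems(1) by (simp add: tm_sort_rename_tm)
  moreover have "wf_tm L (rename_tm \<rho> t)" if "t \<in> set ts" for t
    by (rule wf_rename_tm[OF Pred.prems(1)]) (use Pred.prems(2) that in simp)
  ultimately have "wf_fm L ?\<phi>'"
    using Pred.prems(2) by (simp del: map_eq_conv)
  moreover have "fv ?\<phi>' \<subseteq> \<rho> ` fv (Pred R ts)"
    by (auto simp: fv_rename_tm)
  ultimately show ?case using * by (intro exI[of _ ?\<phi>'] conjI)
next
  case (Neg \<phi>)
  from Neg.IH[OF Neg.prems(1)] Neg.prems(2) obtain \<phi>' where
    "wf_fm L \<phi>'" "fv \<phi>' \<subseteq> \<rho> ` fv \<phi>" "\<forall>e. sat M e \<phi>' = sat M (\<lambda>v. e (\<rho> v)) \<phi>"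
    by auto
  then show ?case by (intro exI[of _ "Neg \<phi>'"]) simp
next
  case (Conj \<phi> \<psi>)
  have "wf_fm L \<phi>" "wf_fm L \<psi>" using Conj.prems by simp_all
  with Conj.IH(1)[OF Conj.prems(1)] Conj.IH(2)[OF Conj.prems(1)] obtain \<phi>' \<psi>' where
    "wf_fm L \<phi>'" "fv \<phi>' \<subseteq> \<rho> ` fv \<phi>" "\<forall>e. sat M e \<phi>' = sat M (\<lambda>v. e (\<rho> v)) \<phi>"
    "wf_fm L \<psi>'" "fv \<psi>' \<subseteq> \<rho> ` fv \<psi>" "\<forall>e. sat M e \<psi>' = sat M (\<lambda>v. e (\<rho> v)) \<psi>"
    by auto
  then show ?case by (intro exI[of _ "Conj \<phi>' \<psi>'"]) auto
next
  case (Exists v \<phi>)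
  \<comment> \<open>The bound variable gets a name outside the image of the free variables, so no
    renamed free variable is captured by the new quantifier.\<close>
  obtain n where "(fst v, n) \<notin> \<rho> ` fv \<phi>"
    using fresh_var[OF finite_imageI[OF finite_fv], of "fst v" \<rho> \<phi>] by (elim exE)
  then have n: "\<rho> u \<noteq> (fst v, n)" if "u \<in> fv \<phi>" for u
    using that by (metis image_eqI)
  define \<rho>' where "\<rho>' = \<rho>(v := (fst v, n))"
  have "\<And>u. fst (\<rho>' u) = fst u" "wf_fm L \<phi>"
    using Exists.prems by (auto simp: \<rho>'_def)
  from Exists.IH[OF this] obtain \<phi>' where \<phi>': "wf_fm L \<phi>'" "fv \<phi>' \<subseteq> \<rho>' ` fv \<phi>"
    "\<forall>e. sat M e \<phi>' = sat M (\<lambda>v. e (\<rho>' v)) \<phi>"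
    by (elim exE conjE)
  have "sat M (\<lambda>u. (e((fst v, n) := x)) (\<rho>' u)) \<phi> = sat M ((\<lambda>v. e (\<rho> v))(v := x)) \<phi>" for e x
    by (rule sat_cong) (use n in \<open>auto simp: \<rho>'_def\<close>)
  then have "sat M e (Exists (fst v, n) \<phi>') = sat M (\<lambda>v. e (\<rho> v)) (Exists v \<phi>)" for e
    by (simp add: \<phi>'(3))
  moreover have "fv (Exists (fst v, n) \<phi>') \<subseteq> \<rho> ` fv (Exists v \<phi>)"
    using \<phi>'(2) by (auto simp: \<rho>'_def split: if_splits)
  ultimately show ?case
    using \<phi>'(1) Exists.prems by (intro exI[of _ "Exists (fst v, n) \<phi>'"]) auto
qed

text \<open>
  The variables of \<open>\<psi>\<close> are shifted by \<open>K\<close> away from those of \<open>\<gamma>\<close>, except those in \<open>V\<close>,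
  which are identified with \<open>y\<close>.
\<close>

lemma exists_conj_formula:
  fixes y :: "'s var"
  assumes "wf_fm L \<gamma>" "wf_fm L \<psi>" "fst y \<in> sorts L" "\<forall>v\<in>V. fst v = fst y"
  shows "\<exists>\<chi> K. wf_fm L \<chi> \<and> (\<forall>v\<in>insert y (fv \<gamma>). snd v < K) \<and>
     fv \<chi> \<subseteq> (fv \<gamma> - {y}) \<union> apsnd ((+) K) ` (fv \<psi> - V) \<and>
     (\<forall>e. sat M e \<chi> \<longleftrightarrow> (\<exists>c\<in>dom M (fst y). sat M (e(y := c)) \<gamma> \<and>
        sat M (\<lambda>v. if v \<in> V then c else e (apsnd ((+) K) v)) \<psi>))"
proof -
  have "finite (snd ` insert y (fv \<gamma>))" by (simp add: finite_fv)
  \<comment> \<open>Every variable of \<open>\<gamma>\<close>, and \<open>y\<close> itself, has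
    index below \<open>K\<close>, so a shifted variable of \<open>\<psi>\<close> never collides with
    them.\<close>
  then obtain K where K: "\<forall>v\<in>insert y (fv \<gamma>). snd v < K"
    using finite_nat_set_iff_bounded by auto
  define \<rho> where "\<rho> v = (if v \<in> V then y else apsnd ((+) K) v)" for v :: "'s var"
  have "fst (\<rho> v) = fst v" for v
    using assms(4) by (auto simp: \<rho>_def)
  from rename_fm[OF this assms(2), of M] obtain \<psi>' where \<psi>':
    "wf_fm L \<psi>'" "fv \<psi>' \<subseteq> \<rho> ` fv \<psi>" "\<forall>e. sat M e \<psi>' = sat M (\<lambda>v. e (\<rho> v)) \<psi>"
    by (elim exE conjE)
  have ne: "apsnd ((+) K) v \<noteq> y" for v
    using K by (cases v; cases y) auto
  have "sat M (e(y := c)) \<psi>' = sat M (\<lambda>v. if v \<in> V then c else e (apsnd ((+) K) v)) \<psi>" for e c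
    unfolding \<psi>'(3)[rule_format] by (rule sat_cong) (auto simp: \<rho>_def ne)
  then have "sat M e (Exists y (Conj \<gamma> \<psi>')) \<longleftrightarrow> (\<exists>c\<in>dom M (fst y). sat M (e(y := c)) \<gamma> \<and>
        sat M (\<lambda>v. if v \<in> V then c else e (apsnd ((+) K) v)) \<psi>)" for e
    by simp
  moreover have "fv (Exists y (Conj \<gamma> \<psi>')) \<subseteq> (fv \<gamma> - {y}) \<union> apsnd ((+) K) ` (fv \<psi> - V)"
    using \<psi>'(2) by (auto simp: \<rho>_def split: if_splits)
  ultimately show ?thesis
    using \<psi>'(1) assms K by (intro exI[of _ "Exists y (Conj \<gamma> \<psi>')"] exI[of _ K]) auto
qed

text \<open>Having exactly one solution is a first-order property of the parameters: some
  \<open>z\<close> exists such that every \<open>y\<close> satisfies \<open>\<gamma>\<close> iff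
  \<open>y = z\<close>. This lets elementary relations carry definitions from one set of parameters
  to another.\<close>

lemma unique_formula:
  assumes "wf_fm L \<gamma>" "fst y \<in> sorts L"
  shows "\<exists>\<chi>. wf_fm L \<chi> \<and> fv \<chi> \<subseteq> fv \<gamma> - {y} \<and>
     (\<forall>e. sat M e \<chi> \<longleftrightarrow> (\<exists>d\<in>dom M (fst y). {c \<in> dom M (fst y). sat M (e(y := c)) \<gamma>} = {d}))"
proof -
  obtain n where n: "(fst y, n) \<notin> insert y (fv \<gamma>)"
    using fresh_var[of "insert y (fv \<gamma>)"] by (auto simp: finite_fv)
  let ?z = "(fst y, n)"
  let ?E = "Equal (Var y) (Var ?z)"
  \<comment> \<open>The universal quantifier and the biconditional are spelled out with
    \<open>Neg\<close>, \<open>Conj\<close> and \<open>Exists\<close>; \<open>z\<close> is fresh for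
    \<open>\<gamma>\<close>.\<close>
  let ?\<chi> = "Exists ?z (Neg (Exists y
     (Neg (Conj (Neg (Conj \<gamma> (Neg ?E))) (Neg (Conj (Neg \<gamma>) ?E))))))"
  have "sat M (e(?z := d, y := c)) \<gamma> = sat M (e(y := c)) \<gamma>" for e c d
    by (rule sat_cong) (use n in auto)
  moreover have "?z \<noteq> y" using n by auto
  ultimately have "sat M e ?\<chi> \<longleftrightarrow>
      (\<exists>d\<in>dom M (fst y). \<forall>c\<in>dom M (fst y). sat M (e(y := c)) \<gamma> \<longleftrightarrow> c = d)" for e
    by simp meson
  moreover have "(\<forall>c\<in>D. P c \<longleftrightarrow> c = d) \<longleftrightarrow> {c \<in> D. P c} = {d}" if "d \<in> D" for D P and d :: 'd
    using that by auto
  ultimately have "sat M e ?\<chi> \<longleftrightarrow>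
      (\<exists>d\<in>dom M (fst y). {c \<in> dom M (fst y). sat M (e(y := c)) \<gamma>} = {d})" for e
    by simp
  then show ?thesis
    using assms by (intro exI[of _ ?\<chi>]) auto
qed

section \<open>Elementary relations and definable closure\<close>

definition unique_sol ::
  "('s, 'f, 'r, 'm) struct \<Rightarrow> 's var \<Rightarrow> ('s, 'f, 'r) fm \<Rightarrow> ('s var \<Rightarrow> 'm) \<Rightarrow> 'm \<Rightarrow> bool" where
  "unique_sol M x \<phi> e d \<longleftrightarrow> {c \<in> dom M (fst x). sat M (e(x := c)) \<phi>} = {d}"

text \<open>Evaluates formulas that quantify over a defined element: the quantifier collapses to the
  element itself.\<close>

lemma unique_sol_bex:
  assumes "unique_sol M x \<phi> e d"
  shows "(\<exists>c\<in>dom M (fst x). sat M (e(x := c)) \<phi> \<and> P c) \<longleftrightarrow> P d"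
proof -
  have "c \<in> dom M (fst x) \<and> sat M (e(x := c)) \<phi> \<longleftrightarrow> c = d" for c
    using assms unfolding unique_sol_def by (simp add: set_eq_iff)
  then show ?thesis unfolding Bex_def by (metis (no_types, lifting))
qed

text \<open>
  Relations rather than partial maps, so that families with repetitions need no special care.
\<close>

definition elementary_rel ::
  "('s, 'f, 'r) lang \<Rightarrow> ('s, 'f, 'r, 'm) struct \<Rightarrow> 'm rel \<Rightarrow> bool" where
  "elementary_rel L M R \<longleftrightarrow>
     (\<forall>\<phi> e e'. wf_fm L \<phi> \<and>
        (\<forall>v\<in>fv \<phi>. (e v, e' v) \<in> R \<and> e v \<in> dom M (fst v) \<and> e' v \<in> dom M (fst v)) \<longrightarrow>
        (sat M e \<phi> \<longleftrightarrow> sat M e' \<phi>))"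

text \<open>Elementarity tests a pair only at variables whose sort contains both components, so it
  says nothing about pairs of elements of different sorts. Arguments that transport sorts along a
  relation therefore ask for inclusion in \<open>same_sort\<close>.\<close>

definition same_sort :: "('s, 'f, 'r) lang \<Rightarrow> ('s, 'f, 'r, 'm) struct \<Rightarrow> 'm rel" where
  "same_sort L M = (\<Union>s\<in>sorts L. dom M s \<times> dom M s)"

lemma elementary_relD:
  assumes "elementary_rel L M R" "wf_fm L \<phi>"
    "\<And>v. v \<in> fv \<phi> \<Longrightarrow> (e v, e' v) \<in> R \<and> e v \<in> dom M (fst v) \<and> e' v \<in> dom M (fst v)"
  shows "sat M e \<phi> \<longleftrightarrow> sat M e' \<phi>"
  using assms(1)[unfolded elementary_rel_def, rule_format, of \<phi> e e'] assms(2,3) by simp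

lemma elementary_relI:
  assumes "\<And>\<phi> e e'. wf_fm L \<phi> \<Longrightarrow>
     \<forall>v\<in>fv \<phi>. (e v, e' v) \<in> R \<and> e v \<in> dom M (fst v) \<and> e' v \<in> dom M (fst v) \<Longrightarrow>
     sat M e \<phi> \<longleftrightarrow> sat M e' \<phi>"
  shows "elementary_rel L M R"
  using assms unfolding elementary_rel_def by simp

lemma elementary_rel_mono:
  assumes "elementary_rel L M S" "R \<subseteq> S"
  shows "elementary_rel L M R"
  by (rule elementary_relI, rule elementary_relD[OF assms(1)]) (use assms(2) in auto)

lemma elementary_rel_converse:
  assumes "elementary_rel L M R"
  shows "elementary_rel L M (R\<inverse>)"
  by (rule elementary_relI, rule elementary_relD[OF assms, symmetric]) auto

lemma elementary_rel_Id_on: "elementary_rel L M (Id_on A)"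
  by (rule elementary_relI, rule sat_cong) auto

text \<open>A formula has finitely many free variables, so each instance involves only finitely many
  of the fixed parameters.\<close>

lemma elementary_rel_Un_finite:
  assumes "\<And>D. finite D \<Longrightarrow> D \<subseteq> A \<Longrightarrow> elementary_rel L M (R \<union> Id_on D)"
  shows "elementary_rel L M (R \<union> Id_on A)"
proof (rule elementary_relI)
  fix \<phi> e e'
  assume *: "wf_fm L \<phi>" "\<forall>v\<in>fv \<phi>. (e v, e' v) \<in> R \<union> Id_on A \<and> e v \<in> dom M (fst v) \<and> e' v \<in> dom M (fst v)"
  have "elementary_rel L M (R \<union> Id_on (e ` fv \<phi> \<inter> A))"
    by (rule assms) (auto simp: finite_fv)
  then show "sat M e \<phi> = sat M e' \<phi>"
    by (rule elementary_relD) (use * in \<open>auto simp: Id_on_def\<close>)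
qed

text \<open>Only the pair of values taken at a variable matters, not the label in
  \<open>X <+> A\<close> that produced it. Equality of types thus becomes a statement about a
  relation on the model.\<close>

lemma same_type_iff_elementary_rel:
  "same_type L M A X f g \<longleftrightarrow> elementary_rel L M ((\<lambda>x. (f x, g x)) ` X \<union> Id_on A)"
    (is "_ \<longleftrightarrow> elementary_rel L M ?R")
proof
  assume st: "same_type L M A X f g"
  show "elementary_rel L M ?R"
  proof (rule elementary_relI)
    fix \<phi> e e'
    assume *: "wf_fm L \<phi>" "\<forall>v\<in>fv \<phi>. (e v, e' v) \<in> ?R \<and> e v \<in> dom M (fst v) \<and> e' v \<in> dom M (fst v)"
    have "\<forall>v\<in>fv \<phi>. \<exists>p. p \<in> X <+> A \<and> case_sum f id p = e v \<and> case_sum g id p = e' v"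
    proof
      fix v assume "v \<in> fv \<phi>"
      then consider x where "x \<in> X" "e v = f x" "e' v = g x" | "e v \<in> A" "e' v = e v"
        using * by blast
      then show "\<exists>p. p \<in> X <+> A \<and> case_sum f id p = e v \<and> case_sum g id p = e' v"
      proof cases
        case 1
        then show ?thesis by (intro exI[of _ "Inl x"]) auto
      next
        case 2
        then show ?thesis by (intro exI[of _ "Inr (e v)"]) auto
      qed
    qed
    then obtain \<pi> where \<pi>: "\<forall>v\<in>fv \<phi>. \<pi> v \<in> X <+> A \<and> case_sum f id (\<pi> v) = e v \<and> case_sum g id (\<pi> v) = e' v"
      by metis
    have "sat M (case_sum f id \<circ> \<pi>) \<phi> = sat M (case_sum g id \<circ> \<pi>) \<phi>"
      using st * \<pi> unfolding same_type_def by simp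
    moreover have "sat M (case_sum f id \<circ> \<pi>) \<phi> = sat M e \<phi>" "sat M (case_sum g id \<circ> \<pi>) \<phi> = sat M e' \<phi>"
      by (rule sat_cong; use \<pi> in simp)+
    ultimately show "sat M e \<phi> = sat M e' \<phi>" by simp
  qed
next
  assume el: "elementary_rel L M ?R"
  show "same_type L M A X f g"
    unfolding same_type_def
  proof (intro allI impI)
    fix \<phi> \<pi>
    assume "wf_fm L \<phi> \<and> (\<forall>v\<in>fv \<phi>. \<pi> v \<in> X <+> A \<and>
           case_sum f id (\<pi> v) \<in> dom M (fst v) \<and> case_sum g id (\<pi> v) \<in> dom M (fst v))"
    then show "sat M (case_sum f id \<circ> \<pi>) \<phi> \<longleftrightarrow> sat M (case_sum g id \<circ> \<pi>) \<phi>"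
      by (intro elementary_relD[OF el]) (auto simp: Id_on_def)
  qed
qed

section \<open>Closure properties of \<open>dcl\<close> and extension of elementary relations along
  it\<close>

context
  fixes L :: "('s, 'f, 'r) lang" and M :: "('s, 'f, 'r, 'm) struct"
  assumes wf: "wf_struct L M"
begin

lemma dom_unique:
  "s \<in> sorts L \<Longrightarrow> s' \<in> sorts L \<Longrightarrow> c \<in> dom M s \<Longrightarrow> c \<in> dom M s' \<Longrightarrow> s = s'"
  using wf unfolding wf_struct_def by blast

lemma same_sortD:
  assumes "(c, c') \<in> same_sort L M" "s \<in> sorts L" "c \<in> dom M s"
  shows "c' \<in> dom M s"
  using assms dom_unique unfolding same_sort_def by blast

lemma same_sort_univ: "A \<subseteq> univ L M \<Longrightarrow> Id_on A \<subseteq> same_sort L M"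
  unfolding same_sort_def univ_def by auto

text \<open>Unlike in \<^const>\<open>fm_over\<close>, the assignment need only respect the sorts of the parameters.\<close>

lemma dcl_iff:
  "d \<in> dcl L M A \<longleftrightarrow> (\<exists>x \<phi> e. fst x \<in> sorts L \<and> wf_fm L \<phi> \<and>
     (\<forall>v\<in>fv \<phi> - {x}. e v \<in> A \<inter> dom M (fst v)) \<and> unique_sol M x \<phi> e d)"
proof
  assume "d \<in> dcl L M A"
  then obtain x \<phi> e where "fst x \<in> sorts L" "(\<phi>, e) \<in> fm_over L M A x" "unique_sol M x \<phi> e d"
    unfolding dcl_def unique_sol_def by blast
  moreover from this have "wf_fm L \<phi>" "\<forall>v\<in>fv \<phi> - {x}. e v \<in> A \<inter> dom M (fst v)"
    using fv_sorts unfolding fm_over_def valid_env_def by fast+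
  ultimately show "\<exists>x \<phi> e. fst x \<in> sorts L \<and> wf_fm L \<phi> \<and>
     (\<forall>v\<in>fv \<phi> - {x}. e v \<in> A \<inter> dom M (fst v)) \<and> unique_sol M x \<phi> e d" by blast
next
  assume "\<exists>x \<phi> e. fst x \<in> sorts L \<and> wf_fm L \<phi> \<and>
     (\<forall>v\<in>fv \<phi> - {x}. e v \<in> A \<inter> dom M (fst v)) \<and> unique_sol M x \<phi> e d"
  then obtain x \<phi> e where *: "fst x \<in> sorts L" "wf_fm L \<phi>"
     "\<forall>v\<in>fv \<phi> - {x}. e v \<in> A \<inter> dom M (fst v)" "unique_sol M x \<phi> e d" by blast
  \<comment> \<open>\<open>fm_over\<close> demands an assignment valid at all variables. Where no
    parameter is prescribed, an arbitrary element of the nonempty sort is chosen.\<close>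
  define e' where "e' v = (if v \<in> fv \<phi> - {x} then e v else SOME c. c \<in> dom M (fst v))" for v
  have "e' v \<in> dom M (fst v)" if "fst v \<in> sorts L" for v
  proof (cases "v \<in> fv \<phi> - {x}")
    case True
    then show ?thesis using *(3) by (simp add: e'_def)
  next
    case False
    have "dom M (fst v) \<noteq> {}" using wf that unfolding wf_struct_def by blast
    then show ?thesis using False by (auto simp: e'_def some_in_eq)
  qed
  then have "valid_env L M e'" by (simp add: valid_env_def)
  moreover have "e' ` (fv \<phi> - {x}) \<subseteq> A" using *(3) by (auto simp: e'_def)
  ultimately have "(\<phi>, e') \<in> fm_over L M A x"
    using *(2) by (simp add: fm_over_def)
  moreover have "sat M (e'(x := c)) \<phi> = sat M (e(x := c)) \<phi>" for c
    by (rule sat_cong) (auto simp: e'_def)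
  ultimately show "d \<in> dcl L M A"
    using * unfolding dcl_def unique_sol_def
    by (intro CollectI exI[of _ x] exI[of _ \<phi>] exI[of _ e']) simp
qed

lemma dclE:
  assumes "d \<in> dcl L M A"
  obtains x \<phi> e where "fst x \<in> sorts L" "wf_fm L \<phi>"
    "\<forall>v\<in>fv \<phi> - {x}. e v \<in> A \<inter> dom M (fst v)" "unique_sol M x \<phi> e d"
  using assms unfolding dcl_iff by (elim exE conjE)

lemma dclI:
  assumes "fst x \<in> sorts L" "wf_fm L \<phi>"
    "\<And>v. v \<in> fv \<phi> - {x} \<Longrightarrow> e v \<in> A \<inter> dom M (fst v)" "unique_sol M x \<phi> e d"
  shows "d \<in> dcl L M A"
  unfolding dcl_iff
  by (intro exI[of _ x] exI[of _ \<phi>] exI[of _ e]) (use assms in simp)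

lemma dcl_mono: "A \<subseteq> B \<Longrightarrow> dcl L M A \<subseteq> dcl L M B"
  by (rule subsetI, erule dclE) (rule dclI, auto)

lemma dcl_univ: "dcl L M A \<subseteq> univ L M"
  by (rule subsetI, erule dclE) (auto simp: univ_def unique_sol_def)

lemma dcl_finite:
  assumes "d \<in> dcl L M A"
  obtains B where "finite B" "B \<subseteq> A" "d \<in> dcl L M B"
proof -
  obtain x \<phi> e where *: "fst x \<in> sorts L" "wf_fm L \<phi>"
     "\<forall>v\<in>fv \<phi> - {x}. e v \<in> A \<inter> dom M (fst v)" "unique_sol M x \<phi> e d"
    using assms by (rule dclE)
  then have "d \<in> dcl L M (e ` (fv \<phi> - {x}))"
    by (intro dclI[of x \<phi> e]) auto
  then show ?thesis
    using that[of "e ` (fv \<phi> - {x})"] * finite_fv by blast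
qed

lemma subset_dcl:
  assumes "A \<subseteq> univ L M"
  shows "A \<subseteq> dcl L M A"
proof
  fix d assume d: "d \<in> A"
  then obtain s where s: "s \<in> sorts L" "d \<in> dom M s"
    using assms unfolding univ_def by blast
  show "d \<in> dcl L M A"
    \<comment> \<open>The defining formula is the equation of the unknown \<open>(s, 0)\<close> with
      the variable \<open>(s, 1)\<close>, which carries the parameter \<open>d\<close>.\<close>
    by (rule dclI[of "(s, 0)" "Equal (Var (s, 0)) (Var (s, 1))" "\<lambda>_. d"])
      (use s d in \<open>auto simp: unique_sol_def\<close>)
qed

text \<open>A formula defining \<open>d\<close> with the help of \<open>c\<close> can quantify over
  the unique solution of a definition of \<open>c\<close> instead of naming
  \<open>c\<close>.\<close>

lemma dcl_insert:
  assumes c: "c \<in> dcl L M A"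
  shows "dcl L M (insert c A) \<subseteq> dcl L M A"
proof
  fix d assume "d \<in> dcl L M (insert c A)"
  then obtain x \<psi> e where \<psi>: "fst x \<in> sorts L" "wf_fm L \<psi>"
     "\<forall>v\<in>fv \<psi> - {x}. e v \<in> insert c A \<inter> dom M (fst v)" "unique_sol M x \<psi> e d"
    by (rule dclE)
  obtain y \<gamma> e0 where \<gamma>: "fst y \<in> sorts L" "wf_fm L \<gamma>"
     "\<forall>v\<in>fv \<gamma> - {y}. e0 v \<in> A \<inter> dom M (fst v)" "unique_sol M y \<gamma> e0 c"
    using c by (rule dclE)
  \<comment> \<open>These are the places where \<open>c\<close> occurs as a parameter. The unknown
    \<open>x\<close> is excluded, since its assigned value is irrelevant and it has to stay
    free.\<close>
  define V where "V = {v \<in> fv \<psi> - {x}. e v = c}"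
  have cy: "c \<in> dom M (fst y)" using \<gamma>(4) unfolding unique_sol_def by auto
  have "\<forall>v\<in>V. fst v = fst y"
  proof
    fix v assume that: "v \<in> V"
    show "fst v = fst y"
    proof (rule dom_unique[OF _ \<gamma>(1) _ cy])
      show "fst v \<in> sorts L" using fv_sorts[OF \<psi>(2)] that by (simp add: V_def)
      show "c \<in> dom M (fst v)" using \<psi>(3) that by (auto simp: V_def)
    qed
  qed
  from exists_conj_formula[where M = M and V = V, OF \<gamma>(2) \<psi>(2) \<gamma>(1) this]
  obtain \<chi> K where \<chi>: "wf_fm L \<chi>" "\<forall>v\<in>insert y (fv \<gamma>). snd v < K"
     "fv \<chi> \<subseteq> (fv \<gamma> - {y}) \<union> apsnd ((+) K) ` (fv \<psi> - V)"
     "\<forall>e. sat M e \<chi> \<longleftrightarrow> (\<exists>c\<in>dom M (fst y). sat M (e(y := c)) \<gamma> \<and>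
        sat M (\<lambda>v. if v \<in> V then c else e (apsnd ((+) K) v)) \<psi>)"
    by (elim exE conjE)
  let ?s = "apsnd ((+) K) :: 's var \<Rightarrow> 's var"
  have s: "fst (?s v) = fst v" "snd (?s v) = K + snd v" "?s v = ?s u \<longleftrightarrow> v = u" for u v
    by (cases v; cases u; simp)+
  \<comment> \<open>Indices below \<open>K\<close> read the parameters defining \<open>c\<close>;
    the others undo the shift and read those of \<open>\<psi>\<close>. The new unknown is
    \<open>?s x\<close>.\<close>
  define E where "E v = (if snd v < K then e0 v else e (fst v, snd v - K))" for v
  have Es: "E (?s v) = e v" for v
    by (cases v) (simp add: E_def)
  have "sat M (E(?s x := t)) \<chi> \<longleftrightarrow> sat M (e(x := t)) \<psi>" for t
  proof -
    have "sat M ((E(?s x := t))(y := u)) \<gamma> = sat M (e0(y := u)) \<gamma>" for u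
      by (rule sat_cong) (use \<chi>(2) in \<open>force simp: E_def s\<close>)
    then have "sat M (E(?s x := t)) \<chi> \<longleftrightarrow>
       sat M (\<lambda>v. if v \<in> V then c else (E(?s x := t)) (?s v)) \<psi>"
      unfolding \<chi>(4)[rule_format] by (simp only: unique_sol_bex[OF \<gamma>(4)])
    also have "\<dots> \<longleftrightarrow> sat M (e(x := t)) \<psi>"
      by (rule sat_cong) (auto simp: V_def s Es)
    finally show ?thesis .
  qed
  then have "unique_sol M (?s x) \<chi> E d"
    using \<psi>(4) by (simp add: unique_sol_def s)
  moreover have "E v \<in> A \<inter> dom M (fst v)" if v: "v \<in> fv \<chi> - {?s x}" for v
  proof -
    consider "v \<in> fv \<gamma> - {y}" | u where "u \<in> fv \<psi> - V" "v = ?s u" "u \<noteq> x"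
      using \<chi>(3) v by blast
    then show ?thesis
    proof cases
      case 1
      then show ?thesis using bspec[OF \<gamma>(3) 1] \<chi>(2) by (auto simp: E_def)
    next
      case 2
      \<comment> \<open>Outside \<open>V\<close> the parameter differs from \<open>c\<close>, hence
        lies in \<open>A\<close>.\<close>
      then show ?thesis using bspec[OF \<psi>(3), of u] by (auto simp: V_def s Es)
    qed
  qed
  ultimately show "d \<in> dcl L M A"
    by (intro dclI[of "?s x" \<chi> E]) (use \<chi>(1) \<psi>(1) s(1) in auto)
qed

text \<open>A definition uses only finitely many elements of \<open>B\<close>, and these are
  absorbed one at a time by \<open>dcl_insert\<close>.\<close>

lemma dcl_subset_dcl:
  assumes "B \<subseteq> dcl L M A"
  shows "dcl L M B \<subseteq> dcl L M A"
proof
  fix d assume "d \<in> dcl L M B"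
  then obtain F where F: "finite F" "F \<subseteq> B" "d \<in> dcl L M F"
    by (rule dcl_finite)
  have "F \<subseteq> dcl L M A" using F(2) assms by blast
  with F(1) have "dcl L M (A \<union> F) \<subseteq> dcl L M A"
  proof (induction F)
    case (insert c F)
    then have "c \<in> dcl L M (A \<union> F)" using dcl_mono[of A "A \<union> F"] by blast
    from dcl_insert[OF this] show ?case using insert by simp
  qed simp
  then show "d \<in> dcl L M A" using F(3) dcl_mono[of F "A \<union> F"] by blast
qed

text \<open>
  A formula about \<open>d\<close> turns into one about the parameters defining \<open>d\<close> by quantifying over the
  unique solution of its definition.
\<close>

lemma elementary_rel_insert:
  assumes R': "elementary_rel L M R'" and sub: "R \<subseteq> R'" and so: "R \<subseteq> same_sort L M"
    and d: "d \<in> dcl L M (Domain R)" and el: "elementary_rel L M (insert (d, d') R)"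
    and dd: "(d, d') \<in> same_sort L M"
  shows "elementary_rel L M (insert (d, d') R')" and "d' \<in> dcl L M (Range R)"
proof -
  obtain y \<gamma> e0 where \<gamma>: "fst y \<in> sorts L" "wf_fm L \<gamma>"
     "\<forall>v\<in>fv \<gamma> - {y}. e0 v \<in> Domain R \<inter> dom M (fst v)" "unique_sol M y \<gamma> e0 d"
    using d by (rule dclE)
  then have "\<forall>v\<in>fv \<gamma> - {y}. \<exists>c. (e0 v, c) \<in> R" by blast
  then obtain e1 where e1: "\<forall>v\<in>fv \<gamma> - {y}. (e0 v, e1 v) \<in> R" by metis
  have e1s: "e1 v \<in> dom M (fst v)" if "v\<in>fv \<gamma> - {y}" for v
    using same_sortD bspec[OF e1 that] so bspec[OF \<gamma>(3) that] fv_sorts[OF \<gamma>(2)] that by blast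
  have dy: "d \<in> dom M (fst y)" using \<gamma>(4) unfolding unique_sol_def by auto
  then have d'y: "d' \<in> dom M (fst y)" using same_sortD[OF dd \<gamma>(1)] by blast
  obtain \<chi>\<^sub>1 where \<chi>\<^sub>1: "wf_fm L \<chi>\<^sub>1" "fv \<chi>\<^sub>1 \<subseteq> fv \<gamma> - {y}"
     "\<And>e. sat M e \<chi>\<^sub>1 \<longleftrightarrow> (\<exists>d\<in>dom M (fst y). unique_sol M y \<gamma> e d)"
    using unique_formula[OF \<gamma>(2,1), of M] unfolding unique_sol_def[symmetric] by auto
  \<comment> \<open>Uniqueness of the solution transfers from \<open>e0\<close> to
    \<open>e1\<close>. Since \<open>d'\<close> satisfies \<open>\<gamma>\<close> under
    \<open>e1\<close> by elementarity on the extended small relation, it is that solution.\<close>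
  have "sat M e0 \<chi>\<^sub>1 = sat M e1 \<chi>\<^sub>1"
    by (rule elementary_relD[OF el \<chi>\<^sub>1(1)]) (use \<chi>\<^sub>1(2) \<gamma>(3) e1 e1s in blast)
  then obtain d1 where "unique_sol M y \<gamma> e1 d1"
    using \<chi>\<^sub>1(3) \<gamma>(4) dy by blast
  moreover have "sat M (e0(y := d)) \<gamma> = sat M (e1(y := d')) \<gamma>"
    by (rule elementary_relD[OF el \<gamma>(2)]) (use \<gamma>(3) e1 e1s dy d'y in auto)
  ultimately have def': "unique_sol M y \<gamma> e1 d'"
    using \<gamma>(4) d'y unfolding unique_sol_def by auto
  then show "d' \<in> dcl L M (Range R)"
    by (intro dclI[of y \<gamma> e1]) (use \<gamma>(1,2) e1 e1s in auto)
  show "elementary_rel L M (insert (d, d') R')"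
  proof (rule elementary_relI)
    fix \<psi> e e'
    assume \<psi>: "wf_fm L \<psi>" and ee: "\<forall>v\<in>fv \<psi>. (e v, e' v) \<in> insert (d, d') R' \<and>
       e v \<in> dom M (fst v) \<and> e' v \<in> dom M (fst v)"
    \<comment> \<open>Variables carrying the new pair are replaced by the quantified solution; all
      other pairs already belong to \<open>R'\<close>.\<close>
    define V where "V = {v \<in> fv \<psi>. e v = d \<and> e' v = d'}"
    have "\<forall>v\<in>V. fst v = fst y"
    proof
      fix v assume that: "v \<in> V"
      show "fst v = fst y"
      proof (rule dom_unique[OF _ \<gamma>(1) _ dy])
        show "fst v \<in> sorts L" using fv_sorts[OF \<psi>] that by (simp add: V_def)
        show "d \<in> dom M (fst v)" using ee that by (auto simp: V_def)
      qed
    qed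
    from exists_conj_formula[where M = M and V = V, OF \<gamma>(2) \<psi> \<gamma>(1) this]
    obtain \<chi> K where \<chi>: "wf_fm L \<chi>" "\<forall>v\<in>insert y (fv \<gamma>). snd v < K"
       "fv \<chi> \<subseteq> (fv \<gamma> - {y}) \<union> apsnd ((+) K) ` (fv \<psi> - V)"
       "\<forall>e. sat M e \<chi> \<longleftrightarrow> (\<exists>c\<in>dom M (fst y). sat M (e(y := c)) \<gamma> \<and>
          sat M (\<lambda>v. if v \<in> V then c else e (apsnd ((+) K) v)) \<psi>)"
      by (elim exE conjE)
    let ?s = "apsnd ((+) K) :: 's var \<Rightarrow> 's var"
    \<comment> \<open>The same merging of assignments serves both sides: \<open>e0\<close> with
      \<open>e\<close> defines \<open>d\<close>, and \<open>e1\<close> with \<open>e'\<close>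
      defines \<open>d'\<close>.\<close>
    define E where "E f g v = (if snd v < K then f v else g (fst v, snd v - K))"
      for f g :: "'s var \<Rightarrow> 'm" and v
    have Es: "E f g (?s v) = g v" for f g v
      by (cases v) (simp add: E_def)
    have Esat: "sat M (E f g) \<chi> \<longleftrightarrow> sat M g \<psi>"
      if def: "unique_sol M y \<gamma> f b" and V: "\<And>v. v \<in> V \<Longrightarrow> g v = b" for f g b
    proof -
      have "sat M ((E f g)(y := u)) \<gamma> = sat M (f(y := u)) \<gamma>" for u
        by (rule sat_cong) (use \<chi>(2) in \<open>force simp: E_def\<close>)
      then have "sat M (E f g) \<chi> \<longleftrightarrow> sat M (\<lambda>v. if v \<in> V then b else E f g (?s v)) \<psi>"
        unfolding \<chi>(4)[rule_format] by (simp only: unique_sol_bex[OF def])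
      also have "\<dots> \<longleftrightarrow> sat M g \<psi>"
        by (rule sat_cong) (auto simp: V Es)
      finally show ?thesis .
    qed
    have "sat M (E e0 e) \<chi> = sat M (E e1 e') \<chi>"
    proof (rule elementary_relD[OF R' \<chi>(1)])
      fix v assume "v \<in> fv \<chi>"
      then consider "v \<in> fv \<gamma> - {y}" | u where "u \<in> fv \<psi> - V" "v = ?s u"
        using \<chi>(3) by blast
      then show "(E e0 e v, E e1 e' v) \<in> R' \<and> E e0 e v \<in> dom M (fst v) \<and> E e1 e' v \<in> dom M (fst v)"
      proof cases
        case 1
        then show ?thesis using bspec[OF \<gamma>(3) 1] bspec[OF e1 1] e1s[OF 1] sub \<chi>(2) by (auto simp: E_def)
      next
        case 2
        moreover have "fst (?s u) = fst u" by (cases u) simp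
        ultimately show ?thesis using ee by (auto simp: V_def Es)
      qed
    qed
    moreover have "sat M (E e0 e) \<chi> \<longleftrightarrow> sat M e \<psi>"
      by (rule Esat[OF \<gamma>(4)]) (simp add: V_def)
    moreover have "sat M (E e1 e') \<chi> \<longleftrightarrow> sat M e' \<psi>"
      by (rule Esat[OF def']) (simp add: V_def)
    ultimately show "sat M e \<psi> = sat M e' \<psi>" by simp
  qed
qed

text \<open>The counterpart of an automorphism fixing \<open>B\<close> pointwise fixing
  \<open>dcl B\<close> pointwise. The small relation is the identity on \<open>B\<close>, whose
  extension by \<open>(d, d)\<close> is again an identity and so elementary.\<close>

lemma elementary_rel_insert_fixed:
  assumes "elementary_rel L M R" "Id_on B \<subseteq> R" "B \<subseteq> univ L M" "d \<in> dcl L M B"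
  shows "elementary_rel L M (insert (d, d) R)"
proof (rule elementary_rel_insert(1)[OF assms(1,2)])
  show "Id_on B \<subseteq> same_sort L M" "d \<in> dcl L M (Domain (Id_on B))"
    using same_sort_univ assms by simp_all
  show "(d, d) \<in> same_sort L M"
    using assms(4) dcl_univ[of B] same_sort_univ[of "{d}"] by blast
  have "insert (d, d) (Id_on B) = Id_on (insert d B)" by auto
  then show "elementary_rel L M (insert (d, d) (Id_on B))"
    using elementary_rel_Id_on by metis
qed

text \<open>Truth passes through an assignment of intermediate values; these have the right sorts
  because \<open>R\<close> preserves sorts, so both relations can be applied.\<close>

lemma elementary_rel_trans:
  assumes R: "elementary_rel L M R" "R \<subseteq> same_sort L M" and S: "elementary_rel L M S"
  shows "elementary_rel L M (R O S)"
proof (rule elementary_relI)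
  fix \<phi> e e'
  assume *: "wf_fm L \<phi>" "\<forall>v\<in>fv \<phi>. (e v, e' v) \<in> R O S \<and> e v \<in> dom M (fst v) \<and> e' v \<in> dom M (fst v)"
  then have "\<forall>v\<in>fv \<phi>. \<exists>c. (e v, c) \<in> R \<and> (c, e' v) \<in> S" by auto
  then obtain f where f: "\<forall>v\<in>fv \<phi>. (e v, f v) \<in> R \<and> (f v, e' v) \<in> S"
    using bchoice[of "fv \<phi>" "\<lambda>v c. (e v, c) \<in> R \<and> (c, e' v) \<in> S"] by auto
  have fs: "f v \<in> dom M (fst v)" if "v \<in> fv \<phi>" for v
    using same_sortD[of "e v" "f v" "fst v"] f R(2) * fv_sorts[OF *(1) that] that by auto
  have "sat M e \<phi> = sat M f \<phi>"
    by (rule elementary_relD[OF R(1) *(1)]) (use f fs * in auto)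
  also have "\<dots> = sat M e' \<phi>"
    by (rule elementary_relD[OF S *(1)]) (use f fs * in auto)
  finally show "sat M e \<phi> = sat M e' \<phi>" .
qed

end

section \<open>Increasing lists of indices\<close>

lemma increasing_append:
  "increasing a (xs @ ys) \<longleftrightarrow> increasing a xs \<and> increasing a ys \<and>
     (\<forall>x\<in>set xs. \<forall>y\<in>set ys. (x, y) \<in> ord a \<and> x \<noteq> y)"
  by (auto simp: increasing_def sorted_wrt_append)

lemma increasing_set: "increasing a xs \<Longrightarrow> set xs \<subseteq> idx a"
  by (simp add: increasing_def)

lemma increasing_take: "increasing a xs \<Longrightarrow> increasing a (take n xs)"
  using increasing_append[of a "take n xs" "drop n xs"] by simp

lemma increasing_distinct: "increasing a xs \<Longrightarrow> distinct xs"
  unfolding increasing_def by (induction xs) auto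

lemma linear_order_on_cases:
  assumes "linear_order_on A r" "i \<in> A" "j \<in> A"
  shows "(i, j) \<in> r \<or> (j, i) \<in> r"
  by (cases "i = j") (use assms in \<open>auto simp: order_on_defs total_on_def refl_on_def\<close>)

lemma linear_order_on_trans: "linear_order_on A r \<Longrightarrow> (i, j) \<in> r \<Longrightarrow> (j, k) \<in> r \<Longrightarrow> (i, k) \<in> r"
  unfolding order_on_defs by (blast dest: transD)

text \<open>The first entry not below \<open>i\<close> is above \<open>i\<close> by linearity, and
  transitivity puts all later entries above \<open>i\<close> as well.\<close>

lemma increasing_split_at:
  assumes lin: "linear_order_on (idx a) (ord a)" and xs: "increasing a xs"
    and i: "i \<in> idx a" "i \<notin> set xs"
  defines "low \<equiv> \<lambda>j. (j, i) \<in> ord a"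
  shows "\<forall>j\<in>set (takeWhile low xs). (j, i) \<in> ord a \<and> j \<noteq> i"
    and "\<forall>j\<in>set (dropWhile low xs). (i, j) \<in> ord a \<and> i \<noteq> j"
proof -
  show "\<forall>j\<in>set (takeWhile low xs). (j, i) \<in> ord a \<and> j \<noteq> i"
    using i by (auto simp: low_def dest: set_takeWhileD)
  show "\<forall>j\<in>set (dropWhile low xs). (i, j) \<in> ord a \<and> i \<noteq> j"
  proof (cases "dropWhile low xs")
    case (Cons j ys)
    have "increasing a (takeWhile low xs @ dropWhile low xs)" using xs by simp
    then have inc: "increasing a (j # ys)" by (simp add: increasing_append Cons)
    have "\<not> low j" using Cons hd_dropWhile[of low xs] by simp
    moreover have "j \<in> idx a" using inc by (simp add: increasing_def)
    ultimately have ij: "(i, j) \<in> ord a"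
      using linear_order_on_cases[OF lin, of i j] i by (auto simp: low_def)
    have "(i, k) \<in> ord a" if "k \<in> set (j # ys)" for k
      using that ij inc linear_order_on_trans[OF lin ij, of k] by (auto simp: increasing_def)
    moreover have "set (dropWhile low xs) \<subseteq> set xs" by (auto dest: set_dropWhileD)
    ultimately show ?thesis using i Cons by auto
  next
    case Nil
    then show ?thesis by (simp only: list.set ball_empty)
  qed
qed

lemma increasing_insert:
  assumes lin: "linear_order_on (idx a) (ord a)" and xs: "increasing a xs"
    and i: "i \<in> idx a" "i \<notin> set xs"
  shows "\<exists>ys. increasing a ys \<and> set ys = insert i (set xs)"
proof -
  define us where "us = takeWhile (\<lambda>j. (j, i) \<in> ord a) xs"
  define vs where "vs = dropWhile (\<lambda>j. (j, i) \<in> ord a) xs"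
  have eq: "xs = us @ vs" by (simp add: us_def vs_def)
  have "\<forall>j\<in>set us. (j, i) \<in> ord a \<and> j \<noteq> i" "\<forall>j\<in>set vs. (i, j) \<in> ord a \<and> i \<noteq> j"
    using increasing_split_at[OF lin xs i] by (simp_all only: us_def vs_def)
  moreover have "increasing a [i]" using i(1) by (simp add: increasing_def)
  ultimately have "increasing a (us @ [i] @ vs)"
    using xs unfolding eq increasing_append by simp
  moreover have "set (us @ [i] @ vs) = insert i (set xs)" using eq by auto
  ultimately show ?thesis by (intro exI[of _ "us @ [i] @ vs"]) simp
qed

lemma finite_increasing:
  assumes lin: "linear_order_on (idx a) (ord a)" and "finite S" "S \<subseteq> idx a"
  shows "\<exists>xs. increasing a xs \<and> set xs = S"
  using assms(2,3)
proof (induction S)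
  case empty
  show ?case by (rule exI[of _ "[]"]) (simp add: increasing_def)
next
  case (insert i S)
  then obtain xs where "increasing a xs" "set xs = S" by auto
  then show ?case using increasing_insert[OF lin, of xs i] insert.hyps insert.prems by simp
qed

lemma infinite_increasing:
  assumes lin: "linear_order_on (idx a) (ord a)" and "infinite K" "K \<subseteq> idx a"
  shows "\<exists>xs. increasing a xs \<and> set xs \<subseteq> K \<and> length xs = n"
proof -
  obtain S where S: "finite S" "card S = n" "S \<subseteq> K"
    using infinite_arbitrarily_large[OF assms(2)] by blast
  then have "finite S" "S \<subseteq> idx a" using assms(3) by auto
  from finite_increasing[OF lin this] obtain xs where xs: "increasing a xs" "set xs = S"
    by (elim exE conjE)
  then have "length xs = n"
    using S(2) distinct_card[OF increasing_distinct[OF xs(1)]] by simp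
  then show ?thesis using S(3) xs by (intro exI[of _ xs]) simp
qed

text \<open>One of the finitely many cells cut out by \<open>xs\<close> is infinite, so there is room for \<open>ys\<close> in it.\<close>

lemma increasing_split:
  assumes lin: "linear_order_on (idx a) (ord a)" and inf: "infinite (idx a)"
    and xs: "increasing a xs"
  obtains us ys vs where "xs = us @ vs" "increasing a (us @ ys @ vs)" "length ys = n"
proof -
  \<comment> \<open>A cell is identified by the entries of \<open>xs\<close> below its points, so
    there are finitely many cells and the pigeonhole principle applies.\<close>
  define cell where "cell i = {j \<in> set xs. (j, i) \<in> ord a}" for i
  have "infinite (idx a - set xs)" using inf by simp
  moreover have "finite (cell ` (idx a - set xs))"
    by (rule finite_subset[of _ "Pow (set xs)"]) (auto simp: cell_def)
  ultimately obtain i where "infinite {k \<in> idx a - set xs. cell k = cell i}"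
    using pigeonhole_infinite by blast
  from infinite_increasing[OF lin this, of n]
  obtain ys where ys: "increasing a ys" "set ys \<subseteq> {k \<in> idx a - set xs. cell k = cell i}" "length ys = n"
    by auto
  define us where "us = takeWhile (\<lambda>j. (j, i) \<in> ord a) xs"
  define vs where "vs = dropWhile (\<lambda>j. (j, i) \<in> ord a) xs"
  have eq: "xs = us @ vs" by (simp add: us_def vs_def)
  then have inc: "increasing a us" "increasing a vs"
    "\<forall>u\<in>set us. \<forall>v\<in>set vs. (u, v) \<in> ord a \<and> u \<noteq> v"
    using xs by (auto simp: increasing_append)
  have "(\<forall>j\<in>set us. (j, k) \<in> ord a \<and> j \<noteq> k) \<and> (\<forall>j\<in>set vs. (k, j) \<in> ord a \<and> k \<noteq> j)"
    if k: "k \<in> set ys" for k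
  proof -
    have k': "k \<in> idx a" "k \<notin> set xs" "cell k = cell i" using k ys(2) by auto
    \<comment> \<open>Points of one cell have the same entries of \<open>xs\<close> below them, so
      each \<open>k\<close> cuts \<open>xs\<close> into the same \<open>us\<close> and
      \<open>vs\<close> as \<open>i\<close>.\<close>
    have iff: "(j, k) \<in> ord a \<longleftrightarrow> (j, i) \<in> ord a" if "j \<in> set xs" for j
      using k'(3) that unfolding cell_def by blast
    have "us = takeWhile (\<lambda>j. (j, k) \<in> ord a) xs" "vs = dropWhile (\<lambda>j. (j, k) \<in> ord a) xs"
      unfolding us_def vs_def using iff by (auto intro: takeWhile_cong dropWhile_cong)
    then show ?thesis using increasing_split_at[OF lin xs k'(1,2)] by simp
  qed
  then have "increasing a (us @ ys @ vs)"
    using inc ys(1) by (auto simp: increasing_append)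
  then show ?thesis using that eq ys(3) by blast
qed

section \<open>Indiscernible sequences and their kernels\<close>

definition tuple_entries :: "('i, 'k, 'm) tseq \<Rightarrow> 'i list \<Rightarrow> 'm set" where
  "tuple_entries a xs = {ent a i k | i k. i \<in> set xs \<and> k \<in> coords a}"

text \<open>The relation that moves the tuples at \<open>xs\<close> to those at \<open>ys\<close>,
  coordinate by coordinate. Two sequences are allowed so that a block can be moved from one into the
  other.\<close>

definition tuple_pairs ::
  "('i, 'k, 'm) tseq \<Rightarrow> 'i list \<Rightarrow> ('j, 'k, 'm) tseq \<Rightarrow> 'j list \<Rightarrow> 'm rel" where
  "tuple_pairs a xs b ys = {(ent a i k, ent b j k) | i j k. (i, j) \<in> set (zip xs ys) \<and> k \<in> coords a}"

lemma tuple_entries_mono: "set xs \<subseteq> set ys \<Longrightarrow> tuple_entries a xs \<subseteq> tuple_entries a ys"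
  unfolding tuple_entries_def by blast

lemma tuple_entries_subset: "increasing a xs \<Longrightarrow> tuple_entries a xs \<subseteq> entries a"
  unfolding tuple_entries_def entries_def increasing_def by blast

lemma tuple_pairs_nth:
  "tuple_pairs a xs b ys = {x. \<exists>n k. n < length xs \<and> n < length ys \<and> k \<in> coords a \<and>
     x = (ent a (xs ! n) k, ent b (ys ! n) k)}"
  unfolding tuple_pairs_def in_set_zip by auto

lemma tuple_pairs_append:
  "length xs = length ys \<Longrightarrow>
     tuple_pairs a (xs @ xs') b (ys @ ys') = tuple_pairs a xs b ys \<union> tuple_pairs a xs' b ys'"
  unfolding tuple_pairs_def by auto

lemma tuple_pairs_self: "tuple_pairs a xs a xs = Id_on (tuple_entries a xs)"
  unfolding tuple_pairs_def tuple_entries_def by (auto simp: zip_same)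

lemma tuple_pairs_converse:
  "coords a = coords b \<Longrightarrow> (tuple_pairs a xs b ys)\<inverse> = tuple_pairs b ys a xs"
  unfolding tuple_pairs_def by (auto simp: in_set_zip)

lemma Range_tuple_pairs:
  assumes "coords a = coords b" "length xs = length ys"
  shows "Range (tuple_pairs a xs b ys) = tuple_entries b ys"
proof -
  have "j \<in> set ys \<longleftrightarrow> (\<exists>i. (i, j) \<in> set (zip xs ys))" for j
    using assms(2) in_set_impl_in_set_zip2 set_zip_rightD by metis
  then show ?thesis
    using assms(1) unfolding tuple_pairs_def tuple_entries_def Range_iff by fast
qed

lemma Domain_tuple_pairs:
  assumes "coords a = coords b" "length xs = length ys"
  shows "Domain (tuple_pairs a xs b ys) = tuple_entries a xs"
proof -
  have "Range ((tuple_pairs a xs b ys)\<inverse>) = tuple_entries a xs"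
    using assms by (simp only: tuple_pairs_converse Range_tuple_pairs)
  then show ?thesis by simp
qed

text \<open>Only an inclusion is claimed: an entry occurring at several positions can produce
  further pairs in the composition.\<close>

lemma tuple_pairs_relcomp:
  assumes "length xs = length ys" "length ys = length zs"
  shows "tuple_pairs a xs a zs \<subseteq> tuple_pairs a xs a ys O tuple_pairs a ys a zs"
proof
  fix p assume "p \<in> tuple_pairs a xs a zs"
  then obtain n k where n: "n < length xs" "k \<in> coords a"
    "p = (ent a (xs ! n) k, ent a (zs ! n) k)"
    by (auto simp: tuple_pairs_def in_set_zip)
  have "(ent a (xs ! n) k, ent a (ys ! n) k) \<in> tuple_pairs a xs a ys"
    "(ent a (ys ! n) k, ent a (zs ! n) k) \<in> tuple_pairs a ys a zs"
    using n assms by (auto simp: tuple_pairs_def in_set_zip)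
  then show "p \<in> tuple_pairs a xs a ys O tuple_pairs a ys a zs" using n(3) by auto
qed

text \<open>The form in which indiscernibility is used from here on: moving one increasing block to
  another of the same length, with \<open>A\<close> fixed, is elementary.\<close>

lemma indiscernible_over_iff:
  "indiscernible_over L M A a \<longleftrightarrow>
     (\<forall>xs ys. increasing a xs \<and> increasing a ys \<and> length xs = length ys \<longrightarrow>
        elementary_rel L M (tuple_pairs a xs a ys \<union> Id_on A))"
proof -
  have "(\<lambda>x. ((\<lambda>(p, k). ent a (xs ! p) k) x, (\<lambda>(p, k). ent a (ys ! p) k) x)) ` ({..<length xs} \<times> coords a) =
      tuple_pairs a xs a ys" if "length xs = length ys" for xs ys
    using that unfolding tuple_pairs_nth by (auto simp: image_iff; blast)
  then show ?thesis
    unfolding indiscernible_over_def same_type_iff_elementary_rel by auto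
qed

lemma indiscernible_overD:
  assumes "indiscernible_over L M A a" "increasing a xs" "increasing a ys" "length xs = length ys"
  shows "elementary_rel L M (tuple_pairs a xs a ys \<union> Id_on A)"
  using assms unfolding indiscernible_over_iff by simp

lemma tuple_pairs_same_sort:
  assumes "tuple_sequence L \<kappa> M a" "increasing a xs" "increasing a ys"
  shows "tuple_pairs a xs a ys \<subseteq> same_sort L M"
proof
  fix p assume "p \<in> tuple_pairs a xs a ys"
  then obtain i j k where "(i, j) \<in> set (zip xs ys)" "k \<in> coords a" "p = (ent a i k, ent a j k)"
    unfolding tuple_pairs_def by blast
  moreover from this have "i \<in> idx a" "j \<in> idx a"
    using increasing_set[OF assms(2)] increasing_set[OF assms(3)]
    by (auto dest: set_zip_leftD set_zip_rightD)
  ultimately show "p \<in> same_sort L M"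
    using assms(1) unfolding tuple_sequence_def same_sort_def by blast
qed

lemma entries_univ: "tuple_sequence L \<kappa> M a \<Longrightarrow> entries a \<subseteq> univ L M"
  unfolding tuple_sequence_def entries_def univ_def by blast

lemma finite_subset_entries:
  assumes "linear_order_on (idx a) (ord a)" "finite B" "B \<subseteq> entries a"
  obtains xs where "increasing a xs" "B \<subseteq> tuple_entries a xs"
proof -
  have "\<forall>c\<in>B. \<exists>i\<in>idx a. \<exists>k\<in>coords a. c = ent a i k"
    using assms(3) unfolding entries_def by blast
  then obtain f where f: "\<forall>c\<in>B. f c \<in> idx a \<and> (\<exists>k\<in>coords a. c = ent a (f c) k)"
    by metis
  then obtain xs where "increasing a xs" "set xs = f ` B"
    using finite_increasing[OF assms(1), of "f ` B"] assms(2) by blast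
  moreover from this have "B \<subseteq> tuple_entries a xs"
    using f unfolding tuple_entries_def by blast
  ultimately show ?thesis using that by blast
qed

section \<open>Definability from blocks of tuples, and parts (3) and (4)\<close>

context
  fixes L :: "('s, 'f, 'r) lang" and M :: "('s, 'f, 'r, 'm) struct"
  assumes wf: "wf_struct L M"
begin

lemma dcl_entries_increasing:
  assumes "linear_order_on (idx a) (ord a)" "d \<in> dcl L M (entries a)"
  obtains xs where "increasing a xs" "d \<in> dcl L M (tuple_entries a xs)"
proof -
  obtain B where B: "finite B" "B \<subseteq> entries a" "d \<in> dcl L M B"
    using dcl_finite[OF wf assms(2)] by blast
  then obtain xs where "increasing a xs" "B \<subseteq> tuple_entries a xs"
    using finite_subset_entries[OF assms(1)] by blast
  then show ?thesis using that B(3) dcl_mono[OF wf] by blast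
qed

text \<open>Some increasing list \<open>ys\<close> defines \<open>d\<close>. Moving it to another
  list of the same length keeps \<open>d\<close> fixed, so that list defines \<open>d\<close> too;
  longer lists are truncated to \<open>length ys\<close>.\<close>

lemma ker_dcl_increasing:
  assumes a: "tuple_sequence L \<kappa> M a" and d: "d \<in> ker L M a"
  shows "\<exists>n. \<forall>xs. increasing a xs \<longrightarrow> n \<le> length xs \<longrightarrow> d \<in> dcl L M (tuple_entries a xs)"
proof -
  have lin: "linear_order_on (idx a) (ord a)" using a by (simp add: tuple_sequence_def)
  have d': "d \<in> dcl L M (entries a)" "indiscernible_over L M {d} a"
    using d by (auto simp: ker_def)
  obtain ys where ys: "increasing a ys" "d \<in> dcl L M (tuple_entries a ys)"
    using dcl_entries_increasing[OF lin d'(1)] by blast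
  have "d \<in> dcl L M (tuple_entries a xs)" if xs: "increasing a xs" "length ys \<le> length xs" for xs
  proof -
    let ?zs = "take (length ys) xs"
    have zs: "increasing a ?zs" "length ys = length ?zs"
      using xs by (auto intro: increasing_take)
    let ?R = "tuple_pairs a ys a ?zs"
    have "elementary_rel L M (?R \<union> Id_on {d})"
      by (rule indiscernible_overD[OF d'(2) ys(1) zs])
    then have el: "elementary_rel L M (insert (d, d) ?R)"
      by (rule elementary_rel_mono) auto
    have "d \<in> dcl L M (Range ?R)"
    proof (rule elementary_rel_insert(2)[OF wf _ subset_refl _ _ el])
      show "elementary_rel L M ?R" using el by (rule elementary_rel_mono) auto
      show "?R \<subseteq> same_sort L M" using tuple_pairs_same_sort[OF a ys(1) zs(1)] .
      show "d \<in> dcl L M (Domain ?R)" using ys(2) zs(2) by (simp add: Domain_tuple_pairs)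
      show "(d, d) \<in> same_sort L M"
        using dcl_univ[OF wf] d'(1) same_sort_univ[OF wf, of "{d}"] by blast
    qed
    then show ?thesis
      using zs(2) dcl_mono[OF wf tuple_entries_mono[OF set_take_subset]]
      by (simp add: Range_tuple_pairs) blast
  qed
  then show ?thesis by (intro exI[of _ "length ys"]) simp
qed

text \<open>Long blocks define every element of \<open>D\<close>. Indiscernibility over each single
  element then suffices, since pairs fixing definable elements can be adjoined one after
  another.\<close>

lemma elementary_rel_ker_finite:
  assumes a: "indiscernible_sequence L \<kappa> M a" and D: "finite D" "D \<subseteq> ker L M a"
  shows "\<exists>n. \<forall>xs ys. increasing a xs \<longrightarrow> increasing a ys \<longrightarrow> length xs = length ys \<longrightarrow>
     n \<le> length xs \<longrightarrow> elementary_rel L M (tuple_pairs a xs a ys \<union> Id_on D)"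
proof -
  have seq: "tuple_sequence L \<kappa> M a" and ind: "indiscernible_over L M {} a"
    using a by (auto simp: indiscernible_sequence_def)
  have "\<forall>d\<in>D. \<exists>n. \<forall>xs. increasing a xs \<longrightarrow> n \<le> length xs \<longrightarrow> d \<in> dcl L M (tuple_entries a xs)"
    using ker_dcl_increasing[OF seq subsetD[OF D(2)]] by (rule ballI)
  from bchoice[OF this] obtain n where
    n: "\<forall>d\<in>D. \<forall>xs. increasing a xs \<longrightarrow> n d \<le> length xs \<longrightarrow> d \<in> dcl L M (tuple_entries a xs)"
    by (elim exE)
  have "elementary_rel L M (tuple_pairs a xs a ys \<union> Id_on D)"
    if inc: "increasing a xs" "increasing a ys" and len: "length xs = length ys" "sum n D \<le> length xs" for xs ys
  proof -
    let ?R = "tuple_pairs a xs a ys"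
    have "elementary_rel L M (?R \<union> Id_on E)" if "finite E" "E \<subseteq> D" for E
      using that
    proof (induction E)
      case empty
      show ?case by (rule indiscernible_overD[OF ind inc len(1)])
    next
      case (insert d E)
      then have d: "d \<in> D" "d \<in> ker L M a" using D(2) by auto
      then have d': "d \<in> dcl L M (entries a)" "indiscernible_over L M {d} a"
        by (auto simp: ker_def)
      \<comment> \<open>The sum serves as a common bound for the finitely many lengths
        \<open>n d\<close>.\<close>
      have "n d \<le> sum n D" by (rule member_le_sum) (use d D(1) in auto)
      then have dom: "d \<in> dcl L M (Domain ?R)"
        using n d(1) inc(1) len by (simp add: Domain_tuple_pairs)
      have "elementary_rel L M (?R \<union> Id_on {d})"
        by (rule indiscernible_overD[OF d'(2) inc len(1)])
      then have el: "elementary_rel L M (insert (d, d) ?R)"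
        by (rule elementary_rel_mono) auto
      have ss: "(d, d) \<in> same_sort L M"
        using dcl_univ[OF wf] d'(1) same_sort_univ[OF wf, of "{d}"] by blast
      have "elementary_rel L M (?R \<union> Id_on E)" using insert by simp
      from elementary_rel_insert(1)[OF wf this Un_upper1 tuple_pairs_same_sort[OF seq inc] dom el ss]
      have "elementary_rel L M (insert (d, d) (?R \<union> Id_on E))" .
      then show ?case by (rule elementary_rel_mono) auto
    qed
    then show ?thesis using D(1) by blast
  qed
  then show ?thesis by (intro exI[of _ "sum n D"]) simp
qed

text \<open>
  A finite part of the kernel is definable from any block of \<open>N\<close> tuples. Inserting such a
  block \<open>ys\<close> into \<open>xs\<close> turns \<open>xs\<close> into a list that depends only on the place of insertion,
  and a second block, the end of \<open>zs\<close>, removes this dependence.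
\<close>

lemma indiscernible_over_ker:
  assumes a: "indiscernible_sequence L \<kappa> M a"
  shows "indiscernible_over L M (ker L M a) a"
  unfolding indiscernible_over_iff
proof (intro allI impI, elim conjE)
  fix xs xs' assume xs: "increasing a xs" and xs': "increasing a xs'" and len: "length xs = length xs'"
  have seq: "tuple_sequence L \<kappa> M a"
    using a by (auto simp: indiscernible_sequence_def)
  then have lin: "linear_order_on (idx a) (ord a)" and inf: "infinite (idx a)"
    by (auto simp: tuple_sequence_def)
  show "elementary_rel L M (tuple_pairs a xs a xs' \<union> Id_on (ker L M a))"
  proof (rule elementary_rel_Un_finite)
    fix D assume D: "finite D" "D \<subseteq> ker L M a"
    obtain N where N: "\<forall>xs ys. increasing a xs \<longrightarrow> increasing a ys \<longrightarrow> length xs = length ys \<longrightarrow>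
       N \<le> length xs \<longrightarrow> elementary_rel L M (tuple_pairs a xs a ys \<union> Id_on D)"
      using elementary_rel_ker_finite[OF a D] by (elim exE)
    have "D \<subseteq> univ L M"
      using D(2) dcl_univ[OF wf] by (auto simp: ker_def)
    then have Dss: "Id_on D \<subseteq> same_sort L M" by (rule same_sort_univ[OF wf])
    have comp: "elementary_rel L M (tuple_pairs a us a ws \<union> Id_on D)"
      if el: "elementary_rel L M (tuple_pairs a us a vs \<union> Id_on D)"
         "elementary_rel L M (tuple_pairs a vs a ws \<union> Id_on D)"
        and inc: "increasing a us" "increasing a vs"
        and len: "length us = length vs" "length vs = length ws" for us vs ws
    proof -
      have "tuple_pairs a us a vs \<union> Id_on D \<subseteq> same_sort L M"
        using tuple_pairs_same_sort[OF seq inc] Dss by simp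
      from elementary_rel_trans[OF wf el(1) this el(2)] show ?thesis
        by (rule elementary_rel_mono) (use tuple_pairs_relcomp[OF len] in auto)
    qed
    let ?n = "length xs"
    \<comment> \<open>The list \<open>zs\<close> has room for the common target \<open>t\<close> of
      length \<open>?n\<close>, for the image of the inserted block, and for a final block
      \<open>e\<close>; both blocks have length \<open>N\<close>.\<close>
    from infinite_increasing[OF lin inf subset_refl, of "?n + N + N"]
    obtain zs where zs: "increasing a zs" "length zs = ?n + N + N"
      by (elim exE conjE)
    define t where "t = take ?n zs"
    have t: "increasing a t" "length t = ?n"
      using zs by (simp_all add: t_def increasing_take)
    have to_t: "elementary_rel L M (tuple_pairs a vs a t \<union> Id_on D)"
      if vs: "increasing a vs" "length vs = ?n" for vs
    proof -
      obtain us ys ws where split: "vs = us @ ws" "increasing a (us @ ys @ ws)" "length ys = N"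
        using increasing_split[OF lin inf vs(1)] by blast
      define l where "l = take (?n + N) zs"
      define e where "e = drop (?n + N) zs"
      \<comment> \<open>The first part of \<open>zs\<close> is cut into pieces matching
        \<open>us\<close>, \<open>ys\<close> and \<open>ws\<close>.\<close>
      define p where "p = take (length us) l"
      define q where "q = take N (drop (length us) l)"
      define r where "r = drop N (drop (length us) l)"
      have zs_eq: "zs = l @ e" by (simp add: l_def e_def)
      have l_eq: "l = p @ q @ r" by (simp only: p_def q_def r_def append_take_drop_id)
      define m where "m = drop ?n l"
      have "t = take ?n l" by (simp add: l_def t_def)
      then have m: "l = t @ m" by (simp add: m_def)
      have lens: "length l = ?n + N" "length e = N" "length p = length us" "length q = N"
        "length r = length ws"
        using zs(2) vs(2) split(1,3) by (simp_all add: l_def e_def p_def q_def r_def)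
      have inc_zs: "increasing a ((p @ q @ r) @ e)" "increasing a ((t @ m) @ e)"
        using zs(1) zs_eq l_eq m by simp_all
      have inc: "increasing a (p @ q @ r)" "increasing a ((p @ r) @ e)" "increasing a (t @ e)"
        using inc_zs unfolding increasing_append by auto
      \<comment> \<open>With \<open>ys\<close> inserted the list is long enough for the bound
        \<open>N\<close>; forgetting the pairs from \<open>ys\<close> to \<open>q\<close> leaves a
        move of \<open>vs\<close> to \<open>p @ r\<close>.\<close>
      have "elementary_rel L M (tuple_pairs a (us @ ys @ ws) a (p @ q @ r) \<union> Id_on D)"
        by (rule N[rule_format, OF split(2) inc(1)]) (use split(3) lens in simp_all)
      then have 1: "elementary_rel L M (tuple_pairs a vs a (p @ r) \<union> Id_on D)"
        by (rule elementary_rel_mono) (use split(1,3) lens in \<open>simp add: tuple_pairs_append; blast\<close>)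
      have pr: "length (p @ r) = length t"
        using lens split(1) vs(2) t(2) by simp
      \<comment> \<open>The block \<open>e\<close> lies above both \<open>p @ r\<close> and
        \<open>t\<close>. Appending it to both again reaches length \<open>N\<close>, and its pairs
        are then dropped.\<close>
      have "elementary_rel L M (tuple_pairs a ((p @ r) @ e) a (t @ e) \<union> Id_on D)"
        by (rule N[rule_format, OF inc(2,3)]) (use lens split(1) vs(2) t(2) in simp_all)
      then have 2: "elementary_rel L M (tuple_pairs a (p @ r) a t \<union> Id_on D)"
        by (rule elementary_rel_mono) (unfold tuple_pairs_append[OF pr], blast)
      show ?thesis
        using comp[OF 1 2 vs(1)] inc(2) lens split(1) vs(2) t(2) by (simp add: increasing_append)
    qed
    have "elementary_rel L M ((tuple_pairs a xs' a t \<union> Id_on D)\<inverse>)"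
      using to_t[OF xs'] len by (intro elementary_rel_converse) simp
    then have "elementary_rel L M (tuple_pairs a t a xs' \<union> Id_on D)"
      by (simp add: converse_Un tuple_pairs_converse)
    then show "elementary_rel L M (tuple_pairs a xs a xs' \<union> Id_on D)"
      using comp[OF to_t[OF xs refl] _ xs t(1)] len t(2) by simp
  qed
qed

text \<open>Elements definable over the kernel stay fixed whenever the kernel does, which by
  indiscernibility over the kernel happens in every move of a block; idempotence of
  \<open>dcl\<close> keeps them definable from the entries.\<close>

lemma dcl_ker:
  assumes a: "indiscernible_sequence L \<kappa> M a"
  shows "dcl L M (ker L M a) = ker L M a"
proof
  have univ: "ker L M a \<subseteq> univ L M"
    using dcl_univ[OF wf] by (auto simp: ker_def)
  then show "ker L M a \<subseteq> dcl L M (ker L M a)"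
    by (rule subset_dcl[OF wf])
  show "dcl L M (ker L M a) \<subseteq> ker L M a"
  proof
    fix d assume d: "d \<in> dcl L M (ker L M a)"
    have "ker L M a \<subseteq> dcl L M (entries a)" by (auto simp: ker_def)
    then have "d \<in> dcl L M (entries a)" using d dcl_subset_dcl[OF wf] by blast
    moreover have "elementary_rel L M (tuple_pairs a xs a ys \<union> Id_on {d})"
      if "increasing a xs" "increasing a ys" "length xs = length ys" for xs ys
    proof -
      have "elementary_rel L M (tuple_pairs a xs a ys \<union> Id_on (ker L M a))"
        by (rule indiscernible_overD[OF indiscernible_over_ker[OF a] that])
      from elementary_rel_insert_fixed[OF wf this _ univ d] show ?thesis
        by (rule elementary_rel_mono[OF _]) auto
    qed
    ultimately show "d \<in> ker L M a"
      unfolding ker_def indiscernible_over_iff by blast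
  qed
qed

end

section \<open>Concatenations, clean collinearity, and parts (1) and (2)\<close>

lemma increasing_concat_seq:
  assumes "increasing a xs" "increasing b ys"
  shows "increasing (concat_seq a b) (map Inl xs @ map Inr ys)"
proof -
  have ord: "(i, j) \<in> ord a \<Longrightarrow> (Inl i, Inl j) \<in> ord (concat_seq a b)"
    "(i', j') \<in> ord b \<Longrightarrow> (Inr i', Inr j') \<in> ord (concat_seq a b)"
    "i \<in> idx a \<Longrightarrow> j' \<in> idx b \<Longrightarrow> (Inl i, Inr j') \<in> ord (concat_seq a b)" for i j i' j'
    unfolding concat_seq_def by (simp_all add: map_prod_imageI)
  have "sorted_wrt (\<lambda>i j. (Inl i, Inl j) \<in> ord (concat_seq a b) \<and> i \<noteq> j) xs"
    by (rule sorted_wrt_mono_rel[OF _ conjunct2[OF assms(1)[unfolded increasing_def]]])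
      (simp add: ord)
  moreover have "sorted_wrt (\<lambda>i j. (Inr i, Inr j) \<in> ord (concat_seq a b) \<and> i \<noteq> j) ys"
    by (rule sorted_wrt_mono_rel[OF _ conjunct2[OF assms(2)[unfolded increasing_def]]])
      (simp add: ord)
  moreover have "(Inl i, Inr j) \<in> ord (concat_seq a b)" if "i \<in> set xs" "j \<in> set ys" for i j
    using assms that by (intro ord) (auto simp: increasing_def)
  moreover have "set (map Inl xs @ map Inr ys) \<subseteq> idx (concat_seq a b)"
    using assms by (auto simp: increasing_def concat_seq_def)
  ultimately show ?thesis
    by (simp add: increasing_def sorted_wrt_append sorted_wrt_map)
qed

lemma tuple_pairs_concat_seq:
  assumes "coords a = coords b"
  shows "tuple_pairs (concat_seq a b) (map Inl xs) (concat_seq a b) (map Inl xs') = tuple_pairs a xs a xs'"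
    "tuple_pairs (concat_seq a b) (map Inl xs) (concat_seq a b) (map Inr ys') = tuple_pairs a xs b ys'"
    "tuple_pairs (concat_seq a b) (map Inr ys) (concat_seq a b) (map Inl xs') = tuple_pairs b ys a xs'"
    "tuple_pairs (concat_seq a b) (map Inr ys) (concat_seq a b) (map Inr ys') = tuple_pairs b ys b ys'"
  by (simp_all add: tuple_pairs_nth concat_seq_def assms cong: conj_cong)

lemma cleanly_collinear_sym: "cleanly_collinear L \<kappa> M a b \<Longrightarrow> cleanly_collinear L \<kappa> M b a"
  unfolding cleanly_collinear_def by auto

text \<open>Blocks of the two sequences can be moved independently of each other: joined in the
  order of the concatenation, they form one increasing list before and after the move.\<close>

lemma cleanly_collinear_elementary_rel:
  assumes "cleanly_collinear L \<kappa> M a b"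
    and "increasing a xs" "increasing a xs'" "length xs = length xs'"
    and "increasing b ys" "increasing b ys'" "length ys = length ys'"
  shows "elementary_rel L M (tuple_pairs a xs a xs' \<union> tuple_pairs b ys b ys')"
proof -
  have co: "coords a = coords b" using assms(1) by (simp add: cleanly_collinear_def)
  consider "indiscernible_over L M {} (concat_seq a b)" | "indiscernible_over L M {} (concat_seq b a)"
    using assms(1) unfolding cleanly_collinear_def indiscernible_sequence_def by blast
  then show ?thesis
  proof cases
    case 1
    have "elementary_rel L M (tuple_pairs (concat_seq a b) (map Inl xs @ map Inr ys)
        (concat_seq a b) (map Inl xs' @ map Inr ys') \<union> Id_on {})"
      by (rule 1[unfolded indiscernible_over_iff, rule_format])
        (use assms in \<open>auto intro: increasing_concat_seq\<close>)
    then show ?thesis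
      using assms(4) by (simp add: tuple_pairs_append tuple_pairs_concat_seq[OF co])
  next
    case 2
    have "elementary_rel L M (tuple_pairs (concat_seq b a) (map Inl ys @ map Inr xs)
        (concat_seq b a) (map Inl ys' @ map Inr xs') \<union> Id_on {})"
      by (rule 2[unfolded indiscernible_over_iff, rule_format])
        (use assms in \<open>auto intro: increasing_concat_seq\<close>)
    then show ?thesis
      using assms(7) by (simp add: tuple_pairs_append tuple_pairs_concat_seq[OF co[symmetric]] Un_commute)
  qed
qed

text \<open>
  A block of \<open>a\<close> is moved into \<open>b\<close> while another one, on the side away from \<open>b\<close>, is kept fixed.
\<close>

lemma cleanly_collinear_move:
  assumes "cleanly_collinear L \<kappa> M a b"
  obtains xs xs' ys where "increasing a xs" "increasing a xs'" "increasing b ys"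
    "length xs = n" "length xs' = n" "length ys = n"
    "elementary_rel L M (Id_on (tuple_entries a xs) \<union> tuple_pairs a xs' b ys)"
    "tuple_pairs a xs' b ys \<subseteq> same_sort L M"
proof -
  have co: "coords a = coords b"
    and lin: "linear_order_on (idx a) (ord a)" "linear_order_on (idx b) (ord b)"
    and inf: "infinite (idx a)" "infinite (idx b)"
    using assms by (simp_all add: cleanly_collinear_def indiscernible_sequence_def tuple_sequence_def)
  \<comment> \<open>One half of this list stays fixed and the other half moves to \<open>ys\<close>.
    If \<open>a\<close> precedes \<open>b\<close>, the upper half \<open>vs\<close> moves; otherwise
    the lower half \<open>us\<close> does.\<close>
  from infinite_increasing[OF lin(1) inf(1) subset_refl, of "n + n"]
  obtain zs where zs: "increasing a zs" "length zs = n + n" by (elim exE conjE)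
  from infinite_increasing[OF lin(2) inf(2) subset_refl, of "n"]
  obtain ys where ys: "increasing b ys" "length ys = n" by (elim exE conjE)
  define us where "us = take n zs"
  define vs where "vs = drop n zs"
  have "zs = us @ vs" by (simp add: us_def vs_def)
  then have inc: "increasing a (us @ vs)" "increasing a us" "increasing a vs"
    using zs(1) by (simp_all add: increasing_append)
  have len: "length us = n" "length vs = n" using zs(2) by (simp_all add: us_def vs_def)
  have nil: "increasing b []" by (simp add: increasing_def)
  consider "indiscernible_sequence L \<kappa> M (concat_seq a b)" | "indiscernible_sequence L \<kappa> M (concat_seq b a)"
    using assms unfolding cleanly_collinear_def by blast
  then show ?thesis
  proof cases
    case 1
    then have c: "tuple_sequence L \<kappa> M (concat_seq a b)" "indiscernible_over L M {} (concat_seq a b)"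
      by (simp_all add: indiscernible_sequence_def)
    have i1: "increasing (concat_seq a b) (map Inl us @ map Inl vs)"
      using increasing_concat_seq[OF inc(1) nil] by simp
    have i2: "increasing (concat_seq a b) (map Inl us @ map Inr ys)"
      using increasing_concat_seq[OF inc(2) ys(1)] .
    have eq: "tuple_pairs (concat_seq a b) (map Inl us @ map Inl vs) (concat_seq a b) (map Inl us @ map Inr ys)
      = Id_on (tuple_entries a us) \<union> tuple_pairs a vs b ys"
      by (simp add: tuple_pairs_append tuple_pairs_concat_seq[OF co] tuple_pairs_self[of a, symmetric])
    have "elementary_rel L M (Id_on (tuple_entries a us) \<union> tuple_pairs a vs b ys)"
      using c(2)[unfolded indiscernible_over_iff, rule_format, of "map Inl us @ map Inl vs" "map Inl us @ map Inr ys"]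
        i1 i2 len ys eq by simp
    moreover have "tuple_pairs a vs b ys \<subseteq> same_sort L M"
      using tuple_pairs_same_sort[OF c(1) i1 i2] eq by simp
    ultimately show ?thesis using that[of us vs ys] inc(2,3) ys len by simp
  next
    case 2
    then have c: "tuple_sequence L \<kappa> M (concat_seq b a)" "indiscernible_over L M {} (concat_seq b a)"
      by (simp_all add: indiscernible_sequence_def)
    have i1: "increasing (concat_seq b a) (map Inr us @ map Inr vs)"
      using increasing_concat_seq[OF nil inc(1)] by simp
    have i2: "increasing (concat_seq b a) (map Inl ys @ map Inr vs)"
      using increasing_concat_seq[OF ys(1) inc(3)] .
    have eq: "tuple_pairs (concat_seq b a) (map Inr us @ map Inr vs) (concat_seq b a) (map Inl ys @ map Inr vs)
      = Id_on (tuple_entries a vs) \<union> tuple_pairs a us b ys"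
      using len ys by (simp add: tuple_pairs_append tuple_pairs_concat_seq[OF co[symmetric]]
        tuple_pairs_self[of a, symmetric] Un_commute)
    have "elementary_rel L M (Id_on (tuple_entries a vs) \<union> tuple_pairs a us b ys)"
      using c(2)[unfolded indiscernible_over_iff, rule_format, of "map Inr us @ map Inr vs" "map Inl ys @ map Inr vs"]
        i1 i2 len ys eq by simp
    moreover have "tuple_pairs a us b ys \<subseteq> same_sort L M"
      using tuple_pairs_same_sort[OF c(1) i1 i2] eq by simp
    ultimately show ?thesis using that[of vs us ys] inc(2,3) ys len by simp
  qed
qed

text \<open>Moving a block of \<open>a\<close> into \<open>b\<close> shows that kernel elements are
  definable from \<open>b\<close>. Conversely, an element definable from \<open>b\<close> stays
  fixed while blocks of \<open>a\<close> move.\<close>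

lemma cleanly_collinear_ker:
  assumes wf: "wf_struct L M" and ab: "cleanly_collinear L \<kappa> M a b"
  shows "ker L M a = dcl L M (entries a) \<inter> dcl L M (entries b)"
proof -
  have co: "coords a = coords b"
    and seq: "tuple_sequence L \<kappa> M a" "tuple_sequence L \<kappa> M b"
    and lin: "linear_order_on (idx b) (ord b)"
    using ab by (simp_all add: cleanly_collinear_def indiscernible_sequence_def tuple_sequence_def)
  have "d \<in> dcl L M (entries b)" if d: "d \<in> ker L M a" for d
  proof -
    obtain n where n: "\<forall>xs. increasing a xs \<longrightarrow> n \<le> length xs \<longrightarrow> d \<in> dcl L M (tuple_entries a xs)"
      using ker_dcl_increasing[OF wf seq(1) d] by (elim exE)
    obtain xs xs' ys where *: "increasing a xs" "increasing a xs'" "increasing b ys"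
      "length xs = n" "length xs' = n" "length ys = n"
      "elementary_rel L M (Id_on (tuple_entries a xs) \<union> tuple_pairs a xs' b ys)"
      "tuple_pairs a xs' b ys \<subseteq> same_sort L M"
      using cleanly_collinear_move[OF ab, of n] .
    have "tuple_entries a xs \<subseteq> univ L M"
      using tuple_entries_subset[OF *(1)] entries_univ[OF seq(1)] by blast
    \<comment> \<open>The fixed block \<open>xs\<close> defines \<open>d\<close>, so
      \<open>d\<close> is fixed too. As \<open>xs'\<close> also defines \<open>d\<close>, its image
      \<open>ys\<close> does as well.\<close>
    then have "elementary_rel L M (insert (d, d) (Id_on (tuple_entries a xs) \<union> tuple_pairs a xs' b ys))"
      using elementary_rel_insert_fixed[OF wf *(7), of "tuple_entries a xs"] n *(1,4) by simp
    then have el: "elementary_rel L M (insert (d, d) (tuple_pairs a xs' b ys))"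
      by (rule elementary_rel_mono) auto
    have "d \<in> dcl L M (Range (tuple_pairs a xs' b ys))"
    proof (rule elementary_rel_insert(2)[OF wf _ subset_refl *(8) _ el])
      show "elementary_rel L M (tuple_pairs a xs' b ys)" using el by (rule elementary_rel_mono) auto
      show "d \<in> dcl L M (Domain (tuple_pairs a xs' b ys))"
        using n * co by (simp add: Domain_tuple_pairs)
      show "(d, d) \<in> same_sort L M"
        using dcl_univ[OF wf] d same_sort_univ[OF wf, of "{d}"] by (auto simp: ker_def)
    qed
    then show ?thesis
      using dcl_mono[OF wf tuple_entries_subset[OF *(3)]] * co by (auto simp: Range_tuple_pairs)
  qed
  moreover have "d \<in> ker L M a" if d: "d \<in> dcl L M (entries a)" "d \<in> dcl L M (entries b)" for d
  proof -
    obtain zs where zs: "increasing b zs" "d \<in> dcl L M (tuple_entries b zs)"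
      using dcl_entries_increasing[OF wf lin d(2)] by blast
    have "elementary_rel L M (tuple_pairs a xs a ys \<union> Id_on {d})"
      if "increasing a xs" "increasing a ys" "length xs = length ys" for xs ys
    proof -
      \<comment> \<open>The block \<open>zs\<close>, which defines \<open>d\<close>, is mapped to
        itself.\<close>
      have "elementary_rel L M (tuple_pairs a xs a ys \<union> tuple_pairs b zs b zs)"
        using cleanly_collinear_elementary_rel[OF ab that zs(1) zs(1)] by simp
      moreover have "tuple_entries b zs \<subseteq> univ L M"
        using tuple_entries_subset[OF zs(1)] entries_univ[OF seq(2)] by blast
      ultimately have "elementary_rel L M (insert (d, d) (tuple_pairs a xs a ys \<union> tuple_pairs b zs b zs))"
        using zs(2) by (intro elementary_rel_insert_fixed[OF wf, of _ "tuple_entries b zs"])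
          (auto simp: tuple_pairs_self)
      then show ?thesis by (rule elementary_rel_mono) auto
    qed
    then show ?thesis using d(1) unfolding ker_def indiscernible_over_iff by blast
  qed
  ultimately show ?thesis by (auto simp: ker_def)
qed

theorem theorem3p8:
  fixes L :: "('s, 'f, 'r) lang" and T :: "('s, 'f, 'r) fm set"
    and \<kappa> :: "'c rel" and M :: "('s, 'f, 'r, 'm) struct"
    and a b :: "('i, 'k, 'm) tseq"
  assumes "complete_consistent_theory L T"
    and "big_saturated_model L T \<kappa> M"
    and "indiscernible_sequence L \<kappa> M a"
    and "indiscernible_sequence L \<kappa> M b"
  shows "(collinear L \<kappa> M a b \<longrightarrow> ker L M a = ker L M b) \<and>
         (cleanly_collinear L \<kappa> M a b \<longrightarrow>
            ker L M a = dcl L M (entries a) \<inter> dcl L M (entries b)) \<and>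
         ker L M a = dcl L M (ker L M a) \<and>
         indiscernible_over L M (ker L M a) a"
proof -
  have wf: "wf_struct L M"
    using assms(2) by (simp add: big_saturated_model_def is_model_def)
  \<comment> \<open>The intersection of the two closures is symmetric, and so is clean
    collinearity.\<close>
  have step: "ker L M c = ker L M c'" if "cleanly_collinear L \<kappa> M c c'"
    for c c' :: "('i, 'k, 'm) tseq"
    using cleanly_collinear_ker[OF wf that] cleanly_collinear_ker[OF wf cleanly_collinear_sym[OF that]]
    by (simp add: Int_commute)
  have "ker L M a = ker L M b" if "collinear L \<kappa> M a b"
    using that unfolding collinear_def by (induction rule: tranclp_induct) (simp_all add: step)
  then show ?thesis
    using cleanly_collinear_ker[OF wf, of \<kappa> a b] dcl_ker[OF wf assms(3)] indiscernible_over_ker[OF wf assms(3)]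
    by simp
qed

end
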